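(* Let $\{S_k; k\ge 1\}$ be a nondecreasing sequence of positive random variables. Suppose there exist a standard Wiener process $\{W(t); t\ge 0\}$ and two positive constants $\mu$ and $\sigma$ such that $$W_n(t):=\frac{S_{[nt]}-[nt]\mu}{\sigma\sqrt{n}}\ \xrightarrow{\mathscr D}\ W(t)\quad\text{in } D[0,1],\ \text{as } n\to\infty,$$ and $$\sup_n \frac{E|S_n-n\mu|}{\sqrt{n}}<\infty.$$ Then, with $\gamma=\mu/\sigma$, $$\left(\prod_{k=1}^{[nt]}\frac{S_k}{k\mu}\right)^{\gamma/\sqrt{n}}\ \xrightarrow{\mathscr D}\ \exp\left\{\int_0^t\frac{W(x)}{x}\,dx\right\}\quad\text{in } D[0,1],\ \text{as } n\to\infty.$$
   Context: $[x]$ denotes the integer part of $x$; an empty product (when $[nt]=0$) equals $1$. $D[0,1]$ is the Skorokhod space of càdlàg functions on $[0,1]$, and $\xrightarrow{\mathscr D}$ denotes convergence in distribution (weak convergence of the processes in $D[0,1]$). *)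

theory Defs
  imports "HOL-Probability.Probability"
begin

text \<open>Skorokhod space D[0,1]: real functions (on the reals; only the values on [0,1]
  matter) that are right-continuous on [0,1) and have left limits on (0,1].\<close>
definition cadlag01 :: "(real \<Rightarrow> real) \<Rightarrow> bool" where
  "cadlag01 x \<longleftrightarrow> (\<forall>t\<in>{0..<1}. continuous (at_right t) x) \<and>
                    (\<forall>t\<in>{0<..1}. \<exists>L. (x \<longlongrightarrow> L) (at_left t))"

definition D01 :: "(real \<Rightarrow> real) set" where
  "D01 = {x. cadlag01 x}"

definition skorokhod_Lambda :: "(real \<Rightarrow> real) set" where
  "skorokhod_Lambda = {l. strict_mono_on {0..1} l \<and> continuous_on {0..1} l \<and> l ` {0..1} = {0..1}}"

definition skorokhod_dist :: "(real \<Rightarrow> real) \<Rightarrow> (real \<Rightarrow> real) \<Rightarrow> real" where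
  "skorokhod_dist x y = Inf {max (SUP t\<in>{0..1}. \<bar>l t - t\<bar>) (SUP t\<in>{0..1}. \<bar>x t - y (l t)\<bar>) | l. l \<in> skorokhod_Lambda}"

definition skorokhod_continuous :: "((real \<Rightarrow> real) \<Rightarrow> real) \<Rightarrow> bool" where
  "skorokhod_continuous f \<longleftrightarrow> (\<forall>x\<in>D01. \<forall>e>0. \<exists>d>0. \<forall>y\<in>D01. skorokhod_dist x y < d \<longrightarrow> \<bar>f y - f x\<bar> < e)"

text \<open>Convergence in distribution in D[0,1] of processes X n (on the probability space M)
  to the process Y (on the probability space N): paths lie (a.s.) in D[0,1], and
  E f(X n) \<rightarrow> E f(Y) for every bounded Skorokhod-continuous functional f.
  Expectations are taken w.r.t. the completed measures (to avoid null-set measurability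
  artefacts).\<close>
definition conv_distr_D :: "'a measure \<Rightarrow> (nat \<Rightarrow> 'a \<Rightarrow> real \<Rightarrow> real) \<Rightarrow> 'b measure \<Rightarrow> ('b \<Rightarrow> real \<Rightarrow> real) \<Rightarrow> bool" where
  "conv_distr_D M X N Y \<longleftrightarrow>
     (\<forall>n. AE \<omega> in M. X n \<omega> \<in> D01) \<and> (AE \<omega> in N. Y \<omega> \<in> D01) \<and>
     (\<forall>f. skorokhod_continuous f \<and> (\<exists>B. \<forall>x\<in>D01. \<bar>f x\<bar> \<le> B) \<longrightarrow>
        (\<lambda>n. integral\<^sup>L (completion M) (\<lambda>\<omega>. f (X n \<omega>)))
          \<longlonglongrightarrow> integral\<^sup>L (completion N) (\<lambda>\<omega>. f (Y \<omega>)))"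

definition standard_wiener_process :: "'b measure \<Rightarrow> (real \<Rightarrow> 'b \<Rightarrow> real) \<Rightarrow> bool" where
  "standard_wiener_process N W \<longleftrightarrow>
     prob_space N \<and>
     (\<forall>t\<ge>0. W t \<in> borel_measurable N) \<and>
     (\<forall>\<omega>\<in>space N. W 0 \<omega> = 0 \<and> continuous_on {0..} (\<lambda>t. W t \<omega>)) \<and>
     (\<forall>s t. 0 \<le> s \<and> s < t \<longrightarrow>
        distributed N lborel (\<lambda>\<omega>. W t \<omega> - W s \<omega>) (normal_density 0 (sqrt (t - s)))) \<and>
     (\<forall>m (u :: nat \<Rightarrow> real). 0 \<le> u 0 \<and> (\<forall>i<m. u i < u (Suc i)) \<longrightarrow>
        prob_space.indep_vars N (\<lambda>_. borel) (\<lambda>i \<omega>. W (u (Suc i)) \<omega> - W (u i) \<omega>) {..<m})"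

end

theory Submission
  imports Defs
begin

text \<open>
  Write \<open>R k = S k / (k \<mu>) - 1\<close>. The moment bound along fourth powers and the monotonicity of \<open>S\<close>
  give \<open>R k \<longrightarrow> 0\<close> almost surely, so \<open>ln (1 + R k) - R k\<close> is almost surely \<open>o(\<bar>R k\<bar>)\<close>, while
  \<open>n\<^sup>-\<^sup>1\<^sup>/\<^sup>2 (\<bar>R 1\<bar> + ... + \<bar>R n\<bar>)\<close> is bounded in \<open>L\<^sup>1\<close>. Hence the logarithm of the product process
  is uniformly close in probability to the integral of \<open>W\<^sub>n(s) / s\<close> over \<open>{\<epsilon>..t}\<close> once \<open>\<epsilon>\<close> is
  small and \<open>n\<close> is large. For fixed \<open>\<epsilon> > 0\<close> this integral is a continuous map from the Skorokhod to
  the uniform topology, so it converges by hypothesis, and since \<open>E \<bar>W s\<bar> / s\<close> is integrable at 0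
  its limit converges as \<open>\<epsilon>\<close> tends to 0. Converging together, tested on Lipschitz functionals, then
  yields convergence of the logarithms for the uniform distance, and \<open>exp\<close> carries it over to the
  Skorokhod topology.
\<close>

section \<open>Weak convergence in pseudometric spaces\<close>

text \<open>The distances need not satisfy any axioms here: \<open>skorokhod_dist\<close> is used without the
  triangle inequality.\<close>
definition seq_continuous ::
  "'c set \<Rightarrow> ('c \<Rightarrow> 'c \<Rightarrow> real) \<Rightarrow> 'e set \<Rightarrow> ('e \<Rightarrow> 'e \<Rightarrow> real) \<Rightarrow> ('c \<Rightarrow> 'e) \<Rightarrow> bool" where
  "seq_continuous E d F d' \<phi> \<longleftrightarrow> \<phi> \<in> E \<rightarrow> F \<and>
     (\<forall>x\<in>E. \<forall>y\<in>UNIV \<rightarrow> E. (\<lambda>m. d x (y m)) \<longlonglongrightarrow> 0 \<longrightarrow> (\<lambda>m. d' (\<phi> x) (\<phi> (y m))) \<longlonglongrightarrow> 0)"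

abbreviation continuous_functional :: "'c set \<Rightarrow> ('c \<Rightarrow> 'c \<Rightarrow> real) \<Rightarrow> ('c \<Rightarrow> real) \<Rightarrow> bool" where
  "continuous_functional E d \<equiv> seq_continuous E d UNIV dist"

lemma continuous_functional_iff:
  "continuous_functional E d g \<longleftrightarrow>
     (\<forall>x\<in>E. \<forall>y\<in>UNIV \<rightarrow> E. (\<lambda>m. d x (y m)) \<longlonglongrightarrow> 0 \<longrightarrow> (\<lambda>m. g (y m)) \<longlonglongrightarrow> g x)"
  by (simp add: seq_continuous_def tendsto_dist_iff[where f = "\<lambda>m. g (_ m)"] dist_commute)

lemma seq_continuous_compose:
  assumes "seq_continuous E d F d' \<phi>" and "seq_continuous F d' G d'' \<psi>"
  shows "seq_continuous E d G d'' (\<lambda>x. \<psi> (\<phi> x))"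
  unfolding seq_continuous_def
proof (intro conjI ballI impI)
  have maps: "\<phi> \<in> E \<rightarrow> F" "\<psi> \<in> F \<rightarrow> G"
    using assms by (simp_all add: seq_continuous_def)
  then show "(\<lambda>x. \<psi> (\<phi> x)) \<in> E \<rightarrow> G" by auto
  fix x y assume x: "x \<in> E" and y: "y \<in> UNIV \<rightarrow> E" and lim: "(\<lambda>m. d x (y m)) \<longlonglongrightarrow> 0"
  have "(\<lambda>m. d' (\<phi> x) (\<phi> (y m))) \<longlonglongrightarrow> 0"
    using assms(1) x y lim by (simp add: seq_continuous_def)
  moreover have "\<phi> x \<in> F" "(\<lambda>m. \<phi> (y m)) \<in> UNIV \<rightarrow> F"
    using maps x y by auto
  ultimately show "(\<lambda>m. d'' (\<psi> (\<phi> x)) (\<psi> (\<phi> (y m)))) \<longlonglongrightarrow> 0"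
    using assms(2) by (simp add: seq_continuous_def)
qed

text \<open>Only Baire measurability is required, since no sigma-algebra on \<open>E\<close> is fixed.\<close>
definition random_element :: "'c set \<Rightarrow> ('c \<Rightarrow> 'c \<Rightarrow> real) \<Rightarrow> 'a measure \<Rightarrow> ('a \<Rightarrow> 'c) \<Rightarrow> bool" where
  "random_element E d M X \<longleftrightarrow> X \<in> space M \<rightarrow> E \<and>
     (\<forall>g. continuous_functional E d g \<longrightarrow> (\<lambda>\<omega>. g (X \<omega>)) \<in> borel_measurable M)"

lemma random_element_mem: "random_element E d M X \<Longrightarrow> \<omega> \<in> space M \<Longrightarrow> X \<omega> \<in> E"
  by (auto simp: random_element_def)

lemma random_element_measurable:
  "random_element E d M X \<Longrightarrow> continuous_functional E d g \<Longrightarrow> (\<lambda>\<omega>. g (X \<omega>)) \<in> borel_measurable M"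
  by (auto simp: random_element_def)

lemma random_element_compose:
  assumes "random_element E d M X" and "seq_continuous E d F d' \<phi>"
  shows "random_element F d' M (\<lambda>\<omega>. \<phi> (X \<omega>))"
  unfolding random_element_def
proof (intro conjI allI impI)
  show "(\<lambda>\<omega>. \<phi> (X \<omega>)) \<in> space M \<rightarrow> F"
    using assms by (auto simp: random_element_def seq_continuous_def)
  show "(\<lambda>\<omega>. g (\<phi> (X \<omega>))) \<in> borel_measurable M" if "continuous_functional F d' g" for g
    by (rule random_element_measurable[OF assms(1) seq_continuous_compose[OF assms(2) that]])
qed

lemma random_element_limit:
  assumes Y: "\<And>m. random_element E d M (Y m)"
    and X: "\<And>\<omega>. \<omega> \<in> space M \<Longrightarrow> X \<omega> \<in> E"
    and lim: "\<And>\<omega>. \<omega> \<in> space M \<Longrightarrow> (\<lambda>m. d (X \<omega>) (Y m \<omega>)) \<longlonglongrightarrow> 0"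
  shows "random_element E d M X"
  unfolding random_element_def
proof (intro conjI funcsetI allI impI X)
  fix g assume g: "continuous_functional E d g"
  show "(\<lambda>\<omega>. g (X \<omega>)) \<in> borel_measurable M"
  proof (rule borel_measurable_LIMSEQ_real)
    show "(\<lambda>m. g (Y m \<omega>)) \<longlonglongrightarrow> g (X \<omega>)" if "\<omega> \<in> space M" for \<omega>
      using g X[OF that] lim[OF that] random_element_mem[OF Y that]
      by (auto simp: continuous_functional_iff)
    show "(\<lambda>\<omega>. g (Y m \<omega>)) \<in> borel_measurable M" for m
      by (rule random_element_measurable[OF Y g])
  qed
qed

lemma (in prob_space) integrable_bounded_functional:
  assumes "random_element E d M X" and "continuous_functional E d g" and "\<And>x. x \<in> E \<Longrightarrow> \<bar>g x\<bar> \<le> B"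
  shows "integrable M (\<lambda>\<omega>. g (X \<omega>))"
  using assms by (intro integrable_const_bound[of _ B])
    (auto simp: random_element_mem random_element_measurable)

definition converges_weakly ::
  "'c set \<Rightarrow> ('c \<Rightarrow> 'c \<Rightarrow> real) \<Rightarrow> 'a measure \<Rightarrow> (nat \<Rightarrow> 'a \<Rightarrow> 'c) \<Rightarrow> 'b measure \<Rightarrow> ('b \<Rightarrow> 'c) \<Rightarrow> bool" where
  "converges_weakly E d M X N Y \<longleftrightarrow>
     (\<forall>g B. continuous_functional E d g \<and> (\<forall>x\<in>E. \<bar>g x\<bar> \<le> B) \<longrightarrow>
        (\<lambda>n. \<integral>\<omega>. g (X n \<omega>) \<partial>M) \<longlonglongrightarrow> (\<integral>\<omega>. g (Y \<omega>) \<partial>N))"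

lemma converges_weaklyD:
  assumes "converges_weakly E d M X N Y" "continuous_functional E d g" "\<And>x. x \<in> E \<Longrightarrow> \<bar>g x\<bar> \<le> B"
  shows "(\<lambda>n. \<integral>\<omega>. g (X n \<omega>) \<partial>M) \<longlonglongrightarrow> (\<integral>\<omega>. g (Y \<omega>) \<partial>N)"
  using assms(2,3) by (intro assms(1)[unfolded converges_weakly_def, rule_format, of g B]) simp

lemma converges_weakly_compose:
  assumes "converges_weakly E d M X N Y" and "seq_continuous E d F d' \<phi>"
  shows "converges_weakly F d' M (\<lambda>n \<omega>. \<phi> (X n \<omega>)) N (\<lambda>\<omega>. \<phi> (Y \<omega>))"
  unfolding converges_weakly_def
proof (intro allI impI, elim conjE)
  fix g B assume g: "continuous_functional F d' g" and B: "\<forall>x\<in>F. \<bar>g x\<bar> \<le> B"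
  have "\<phi> \<in> E \<rightarrow> F" using assms(2) by (simp add: seq_continuous_def)
  with B show "(\<lambda>n. \<integral>\<omega>. g (\<phi> (X n \<omega>)) \<partial>M) \<longlonglongrightarrow> (\<integral>\<omega>. g (\<phi> (Y \<omega>)) \<partial>N)"
    by (intro converges_weaklyD[OF assms(1) seq_continuous_compose[OF assms(2) g]]) auto
qed

lemma converges_weakly_if_AE:
  assumes N: "prob_space N" and Y: "\<And>j. random_element E d N (Y j)" and Z: "random_element E d N Z"
    and lim: "AE \<omega> in N. (\<lambda>j. d (Z \<omega>) (Y j \<omega>)) \<longlonglongrightarrow> 0"
  shows "converges_weakly E d N Y N Z"
  unfolding converges_weakly_def
proof (intro allI impI, elim conjE)
  fix g B assume g: "continuous_functional E d g" and B: "\<forall>x\<in>E. \<bar>g x\<bar> \<le> B"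
  interpret prob_space N by (rule N)
  show "(\<lambda>j. \<integral>\<omega>. g (Y j \<omega>) \<partial>N) \<longlonglongrightarrow> (\<integral>\<omega>. g (Z \<omega>) \<partial>N)"
  proof (rule integral_dominated_convergence[where w = "\<lambda>_. B"])
    show "AE \<omega> in N. (\<lambda>j. g (Y j \<omega>)) \<longlonglongrightarrow> g (Z \<omega>)"
      using lim AE_space
    proof eventually_elim
      case (elim \<omega>)
      then show ?case using g random_element_mem[OF Y] random_element_mem[OF Z]
        by (auto simp: continuous_functional_iff)
    qed
    show "AE \<omega> in N. norm (g (Y j \<omega>)) \<le> B" for j
      using B random_element_mem[OF Y] by (intro AE_I2) auto
  qed (use random_element_measurable[OF Y g] random_element_measurable[OF Z g] in auto)
qed

definition lipschitz_functional :: "'c set \<Rightarrow> ('c \<Rightarrow> 'c \<Rightarrow> real) \<Rightarrow> real \<Rightarrow> ('c \<Rightarrow> real) \<Rightarrow> bool" where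
  "lipschitz_functional E d K g \<longleftrightarrow> 0 \<le> K \<and> (\<forall>x\<in>E. \<forall>y\<in>E. \<bar>g x - g y\<bar> \<le> K * d x y)"

lemma lipschitz_functional_continuous:
  assumes "lipschitz_functional E d K g"
  shows "continuous_functional E d g"
  unfolding continuous_functional_iff
proof (intro ballI impI)
  fix x y assume x: "x \<in> E" and y: "y \<in> UNIV \<rightarrow> E" and lim: "(\<lambda>m. d x (y m)) \<longlonglongrightarrow> 0"
  have "(\<lambda>m. g (y m) - g x) \<longlonglongrightarrow> 0"
  proof (rule Lim_null_comparison)
    show "\<forall>\<^sub>F m in sequentially. norm (g (y m) - g x) \<le> K * d x (y m)"
      using assms x y by (intro always_eventually)
        (auto simp: lipschitz_functional_def abs_minus_commute)
    show "(\<lambda>m. K * d x (y m)) \<longlonglongrightarrow> 0"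
      using tendsto_mult_right_zero[OF lim] .
  qed
  then show "(\<lambda>m. g (y m)) \<longlonglongrightarrow> g x" by (simp add: LIM_zero_iff)
qed

lemma lipschitz_functional_diff_le:
  assumes g: "lipschitz_functional E d K g" and B: "\<And>x. x \<in> E \<Longrightarrow> \<bar>g x\<bar> \<le> B"
    and x: "x \<in> E" and y: "y \<in> E" and e: "0 \<le> e"
  shows "\<bar>g x - g y\<bar> \<le> K * e + (if d x y \<le> e then 0 else 2 * B)"
proof (cases "d x y \<le> e")
  case True
  have "\<bar>g x - g y\<bar> \<le> K * d x y" and "0 \<le> K"
    using g x y by (auto simp: lipschitz_functional_def)
  with True mult_left_mono[OF True \<open>0 \<le> K\<close>] show ?thesis by simp
next
  case False
  have "0 \<le> K * e" using g e by (simp add: lipschitz_functional_def)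
  with False B[OF x] B[OF y] show ?thesis by simp
qed

definition lipschitz_envelope :: "'c set \<Rightarrow> ('c \<Rightarrow> 'c \<Rightarrow> real) \<Rightarrow> real \<Rightarrow> ('c \<Rightarrow> real) \<Rightarrow> 'c \<Rightarrow> real" where
  "lipschitz_envelope E d k g x = (INF y\<in>E. g y + k * d x y)"

text \<open>The event \<open>G\<close> makes it unnecessary for \<open>d (X \<omega>) (Y \<omega>)\<close> to be measurable in \<open>\<omega>\<close>.\<close>
definition close_in_prob :: "('c \<Rightarrow> 'c \<Rightarrow> real) \<Rightarrow> real \<Rightarrow> 'a measure \<Rightarrow> ('a \<Rightarrow> 'c) \<Rightarrow> ('a \<Rightarrow> 'c) \<Rightarrow> bool"
  where
  "close_in_prob d e M X Y \<longleftrightarrow>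
     (\<exists>G\<in>sets M. measure M (space M - G) \<le> e \<and> (\<forall>\<omega>\<in>G. d (X \<omega>) (Y \<omega>) \<le> e))"

lemma (in prob_space) close_in_prob_if_dominated:
  assumes e: "0 < e" and G: "G \<in> events" "prob (space M - G) \<le> e / 2"
    and err: "integrable M err" "\<And>\<omega>. 0 \<le> err \<omega>" "expectation err \<le> e\<^sup>2 / 2"
    and dominated: "\<And>\<omega>. \<omega> \<in> G \<Longrightarrow> d (X \<omega>) (Y \<omega>) \<le> err \<omega>"
  shows "close_in_prob d e M X Y"
  unfolding close_in_prob_def
proof (intro bexI conjI ballI)
  define bad where "bad = {\<omega> \<in> space M. e \<le> err \<omega>}"
  have bad: "bad \<in> events"
    unfolding bad_def using err(1) by measurable
  show "G - bad \<in> events" using G(1) bad by auto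
  have "prob bad \<le> expectation err / e"
    unfolding bad_def by (rule integral_Markov_inequality_measure[OF err(1) sets.top _ e])
       (simp add: err(2))
  also have "\<dots> \<le> e / 2" using err(3) e by (simp add: divide_le_eq power2_eq_square)
  finally have "prob bad \<le> e / 2" .
  moreover have "space M - (G - bad) = (space M - G) \<union> bad"
    by (auto simp: bad_def)
  ultimately show "prob (space M - (G - bad)) \<le> e"
    using measure_Un_le[of "space M - G" M bad] G bad by auto
  show "d (X \<omega>) (Y \<omega>) \<le> e" if "\<omega> \<in> G - bad" for \<omega>
    using that dominated[of \<omega>] sets.sets_into_space[OF G(1)] by (auto simp: bad_def)
qed

locale pseudometric_space =
  fixes E :: "'c set" and d :: "'c \<Rightarrow> 'c \<Rightarrow> real"
  assumes nonneg: "\<And>x y. \<lbrakk>x \<in> E; y \<in> E\<rbrakk> \<Longrightarrow> 0 \<le> d x y"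
    and refl_zero: "\<And>x. x \<in> E \<Longrightarrow> d x x = 0"
    and commute: "\<And>x y. \<lbrakk>x \<in> E; y \<in> E\<rbrakk> \<Longrightarrow> d x y = d y x"
    and triangle: "\<And>x y z. \<lbrakk>x \<in> E; y \<in> E; z \<in> E\<rbrakk> \<Longrightarrow> d x z \<le> d x y + d y z"
begin

context
  fixes g :: "'c \<Rightarrow> real" and B k :: real
  assumes bounded: "\<And>x. x \<in> E \<Longrightarrow> \<bar>g x\<bar> \<le> B" and k: "0 \<le> k"
begin

lemma penalised_lower_bound:
  assumes "x \<in> E" "y \<in> E"
  shows "- B \<le> g y + k * d x y"
  using mult_nonneg_nonneg[OF k nonneg[OF assms]] bounded[OF assms(2)] by linarith

lemma penalised_bdd_below: "x \<in> E \<Longrightarrow> bdd_below ((\<lambda>y. g y + k * d x y) ` E)"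
  by (rule bdd_belowI2) (rule penalised_lower_bound)

lemma lipschitz_envelope_lower:
  "x \<in> E \<Longrightarrow> y \<in> E \<Longrightarrow> lipschitz_envelope E d k g x \<le> g y + k * d x y"
  unfolding lipschitz_envelope_def by (intro cINF_lower penalised_bdd_below)

lemma lipschitz_envelope_greatest:
  "x \<in> E \<Longrightarrow> (\<And>y. y \<in> E \<Longrightarrow> c \<le> g y + k * d x y) \<Longrightarrow> c \<le> lipschitz_envelope E d k g x"
  unfolding lipschitz_envelope_def by (intro cINF_greatest) auto

lemma lipschitz_envelope_le: "x \<in> E \<Longrightarrow> lipschitz_envelope E d k g x \<le> g x"
  using lipschitz_envelope_lower[of x x] by (simp add: refl_zero)

lemma lipschitz_envelope_bounded:
  assumes "x \<in> E" shows "\<bar>lipschitz_envelope E d k g x\<bar> \<le> B"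
proof -
  have "- B \<le> lipschitz_envelope E d k g x"
    by (intro lipschitz_envelope_greatest penalised_lower_bound assms)
  then show ?thesis using lipschitz_envelope_le[OF assms] bounded[OF assms] by linarith
qed

lemma lipschitz_envelope_diff_le:
  assumes "x \<in> E" "x' \<in> E"
  shows "lipschitz_envelope E d k g x - k * d x x' \<le> lipschitz_envelope E d k g x'"
proof (rule lipschitz_envelope_greatest)
  fix y assume "y \<in> E"
  then have "lipschitz_envelope E d k g x \<le> g y + k * d x y"
    using assms by (intro lipschitz_envelope_lower)
  also have "\<dots> \<le> g y + k * (d x x' + d x' y)"
    using assms \<open>y \<in> E\<close> k by (intro add_left_mono mult_left_mono triangle)
  finally show "lipschitz_envelope E d k g x - k * d x x' \<le> g y + k * d x' y"
    by (simp add: algebra_simps)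
qed fact

lemma lipschitz_envelope_lipschitz: "lipschitz_functional E d k (lipschitz_envelope E d k g)"
  unfolding lipschitz_functional_def
proof (intro conjI k ballI)
  fix x y assume "x \<in> E" "y \<in> E"
  then show "\<bar>lipschitz_envelope E d k g x - lipschitz_envelope E d k g y\<bar> \<le> k * d x y"
    using lipschitz_envelope_diff_le[of x y] lipschitz_envelope_diff_le[of y x] commute[of x y] by simp
qed

end

text \<open>Near-minimizers \<open>y k\<close> of the penalised functional are forced towards \<open>x\<close> since \<open>g\<close> is bounded.\<close>
lemma lipschitz_envelope_tendsto:
  assumes g: "continuous_functional E d g" and bounded: "\<And>x. x \<in> E \<Longrightarrow> \<bar>g x\<bar> \<le> B" and x: "x \<in> E"
  shows "(\<lambda>k. lipschitz_envelope E d (real k) g x) \<longlonglongrightarrow> g x"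
proof -
  define env where "env k = lipschitz_envelope E d (real k) g x" for k
  have env_le: "env k \<le> g x" for k
    unfolding env_def by (rule lipschitz_envelope_le[OF bounded _ x]) simp_all
  have "\<exists>y\<in>E. g y + real k * d x y < env k + 1 / real (Suc k)" for k
    using x penalised_bdd_below[OF bounded of_nat_0_le_iff x]
    by (subst cINF_less_iff[symmetric]) (auto simp: env_def lipschitz_envelope_def)
  then obtain y where y: "\<And>k. y k \<in> E" "\<And>k. g (y k) + real k * d x (y k) < env k + 1 / real (Suc k)"
    by metis
  have inverse_to_0: "(\<lambda>k. 1 / real (Suc k)) \<longlonglongrightarrow> 0"
    by (rule LIMSEQ_Suc[OF lim_1_over_n])
  have "(\<lambda>k. d x (y k)) \<longlonglongrightarrow> 0"
  proof (rule tendsto_sandwich[OF _ _ tendsto_const])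
    show "\<forall>\<^sub>F k in sequentially. d x (y k) \<le> (2 * B + 1) / real k"
      using eventually_gt_at_top[of 0]
    proof eventually_elim
      case (elim k)
      have "1 / real (Suc k) \<le> 1" by simp
      then have "real k * d x (y k) \<le> 2 * B + 1"
        using y(2)[of k] env_le[of k] bounded[OF x] bounded[OF y(1)[of k]] by linarith
      with elim show ?case by (simp add: field_simps)
    qed
    show "(\<lambda>k. (2 * B + 1) / real k) \<longlonglongrightarrow> 0"
      by (intro tendsto_divide_0[OF tendsto_const] filterlim_at_top_imp_at_infinity
          filterlim_real_sequentially)
  qed (use nonneg[OF x y(1)] in auto)
  with g x y(1) have "(\<lambda>k. g (y k)) \<longlonglongrightarrow> g x"
    by (auto simp: continuous_functional_iff)
  from tendsto_diff[OF this inverse_to_0] have "(\<lambda>k. g (y k) - 1 / real (Suc k)) \<longlonglongrightarrow> g x"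
    by simp
  moreover have "g (y k) - 1 / real (Suc k) \<le> env k" for k
    using y(2)[of k] mult_nonneg_nonneg[OF of_nat_0_le_iff[of k] nonneg[OF x y(1)[of k]]] by linarith
  ultimately have "env \<longlonglongrightarrow> g x"
    using env_le by (intro tendsto_sandwich[of "\<lambda>k. g (y k) - 1 / real (Suc k)" env _ "\<lambda>_. g x"]) auto
  then show ?thesis by (simp add: env_def[abs_def])
qed

context
  fixes M :: "'a measure" and N :: "'b measure" and X :: "nat \<Rightarrow> 'a \<Rightarrow> 'c" and Y :: "'b \<Rightarrow> 'c"
  assumes M: "prob_space M" and N: "prob_space N"
    and X: "\<And>n. random_element E d M (X n)" and Y: "random_element E d N Y"
    and lipschitz_tendsto: "\<And>g K B. \<lbrakk>lipschitz_functional E d K g; \<And>x. x \<in> E \<Longrightarrow> \<bar>g x\<bar> \<le> B\<rbrakk> \<Longrightarrow>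
      (\<lambda>n. \<integral>\<omega>. g (X n \<omega>) \<partial>M) \<longlonglongrightarrow> (\<integral>\<omega>. g (Y \<omega>) \<partial>N)"
begin

lemma eventually_expectation_gt_if_lipschitz:
  assumes g: "continuous_functional E d g" and B: "\<And>x. x \<in> E \<Longrightarrow> \<bar>g x\<bar> \<le> B"
    and a: "a < (\<integral>\<omega>. g (Y \<omega>) \<partial>N)"
  shows "\<forall>\<^sub>F n in sequentially. a < (\<integral>\<omega>. g (X n \<omega>) \<partial>M)"
proof -
  interpret M: prob_space M by (rule M)
  interpret N: prob_space N by (rule N)
  define env where "env k = lipschitz_envelope E d (real k) g" for k
  have env_lipschitz: "lipschitz_functional E d (real k) (env k)" for k
    unfolding env_def by (rule lipschitz_envelope_lipschitz[OF B]) simp_all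
  have env_continuous: "continuous_functional E d (env k)" for k
    by (rule lipschitz_functional_continuous[OF env_lipschitz])
  have env_bounded: "\<bar>env k x\<bar> \<le> B" if "x \<in> E" for k x
    unfolding env_def by (rule lipschitz_envelope_bounded[OF B _ that]) simp_all
  have "(\<lambda>k. \<integral>\<omega>. env k (Y \<omega>) \<partial>N) \<longlonglongrightarrow> (\<integral>\<omega>. g (Y \<omega>) \<partial>N)"
  proof (rule integral_dominated_convergence[where w = "\<lambda>_. B"])
    show "AE \<omega> in N. (\<lambda>k. env k (Y \<omega>)) \<longlonglongrightarrow> g (Y \<omega>)"
      unfolding env_def by (intro AE_I2 lipschitz_envelope_tendsto[OF g B] random_element_mem[OF Y])
    show "AE \<omega> in N. norm (env k (Y \<omega>)) \<le> B" for k
      using env_bounded random_element_mem[OF Y] by (intro AE_I2) simp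
  qed (use random_element_measurable[OF Y g] random_element_measurable[OF Y env_continuous] in auto)
  from order_tendstoD(1)[OF this a] obtain k where "a < (\<integral>\<omega>. env k (Y \<omega>) \<partial>N)"
    by (auto simp: eventually_sequentially)
  with lipschitz_tendsto[OF env_lipschitz env_bounded]
  have "\<forall>\<^sub>F n in sequentially. a < (\<integral>\<omega>. env k (X n \<omega>) \<partial>M)"
    by (rule order_tendstoD(1))
  moreover have "(\<integral>\<omega>. env k (X n \<omega>) \<partial>M) \<le> (\<integral>\<omega>. g (X n \<omega>) \<partial>M)" for n
  proof (rule integral_mono)
    show "env k (X n \<omega>) \<le> g (X n \<omega>)" if "\<omega> \<in> space M" for \<omega>
      unfolding env_def by (rule lipschitz_envelope_le[OF B _ random_element_mem[OF X that]]) simp_all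
  qed (rule M.integrable_bounded_functional[OF X env_continuous env_bounded]
            M.integrable_bounded_functional[OF X g B]; assumption)+
  ultimately show ?thesis
    by (auto elim!: eventually_mono intro: less_le_trans)
qed

lemma converges_weakly_if_lipschitz: "converges_weakly E d M X N Y"
  unfolding converges_weakly_def
proof (intro allI impI, elim conjE)
  fix g B assume g: "continuous_functional E d g" and B: "\<forall>x\<in>E. \<bar>g x\<bar> \<le> B"
  have neg: "continuous_functional E d (\<lambda>x. - g x)"
    using g by (auto simp: continuous_functional_iff intro!: tendsto_minus)
  show "(\<lambda>n. \<integral>\<omega>. g (X n \<omega>) \<partial>M) \<longlonglongrightarrow> (\<integral>\<omega>. g (Y \<omega>) \<partial>N)"
  proof (rule order_tendstoI)
    show "\<forall>\<^sub>F n in sequentially. a < (\<integral>\<omega>. g (X n \<omega>) \<partial>M)" if "a < (\<integral>\<omega>. g (Y \<omega>) \<partial>N)" for a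
      using B by (intro eventually_expectation_gt_if_lipschitz[OF g _ that, of B]) auto
    show "\<forall>\<^sub>F n in sequentially. (\<integral>\<omega>. g (X n \<omega>) \<partial>M) < a" if "(\<integral>\<omega>. g (Y \<omega>) \<partial>N) < a" for a
      using B that eventually_expectation_gt_if_lipschitz[OF neg, of B "- a"] by simp
  qed
qed

end

lemma expectation_diff_le_if_close_in_prob:
  assumes M: "prob_space M" and X: "random_element E d M X" and Y: "random_element E d M Y"
    and g: "lipschitz_functional E d K g" and B: "\<And>x. x \<in> E \<Longrightarrow> \<bar>g x\<bar> \<le> B"
    and close: "close_in_prob d e M X Y"
  shows "\<bar>(\<integral>\<omega>. g (X \<omega>) \<partial>M) - (\<integral>\<omega>. g (Y \<omega>) \<partial>M)\<bar> \<le> (K + 2 * B) * e"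
proof -
  interpret prob_space M by (rule M)
  obtain G where G: "G \<in> events" "prob (space M - G) \<le> e"
    and near: "\<And>\<omega>. \<omega> \<in> G \<Longrightarrow> d (X \<omega>) (Y \<omega>) \<le> e"
    using close unfolding close_in_prob_def by blast
  note in_E = random_element_mem[OF X] random_element_mem[OF Y]
  have B_nonneg: "0 \<le> B"
    using not_empty B[OF in_E(1)] abs_ge_zero order_trans by blast
  have e_nonneg: "0 \<le> e" using measure_nonneg G(2) by (rule order_trans)
  have integrable: "integrable M (\<lambda>\<omega>. g (X \<omega>))" "integrable M (\<lambda>\<omega>. g (Y \<omega>))"
    using integrable_bounded_functional[OF _ lipschitz_functional_continuous[OF g] B] X Y by blast+
  have integrable_bad: "integrable M (indicat_real (space M - G))"
    using G(1) by (intro integrable_real_indicator) (auto simp: emeasure_eq_measure)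
  have pointwise: "\<bar>g (X \<omega>) - g (Y \<omega>)\<bar> \<le> K * e + 2 * B * indicator (space M - G) \<omega>"
    if \<omega>: "\<omega> \<in> space M" for \<omega>
    using lipschitz_functional_diff_le[OF g B in_E(1)[OF \<omega>] in_E(2)[OF \<omega>] e_nonneg]
      near[of \<omega>] B_nonneg \<omega> by (auto simp: indicator_def split: if_splits)
  have "\<bar>(\<integral>\<omega>. g (X \<omega>) \<partial>M) - (\<integral>\<omega>. g (Y \<omega>) \<partial>M)\<bar> = \<bar>\<integral>\<omega>. g (X \<omega>) - g (Y \<omega>) \<partial>M\<bar>"
    using integrable by simp
  also have "\<dots> \<le> (\<integral>\<omega>. \<bar>g (X \<omega>) - g (Y \<omega>)\<bar> \<partial>M)"
    by (rule integral_abs_bound)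
  also have "\<dots> \<le> (\<integral>\<omega>. K * e + 2 * B * indicator (space M - G) \<omega> \<partial>M)"
    using integrable integrable_bad by (intro integral_mono pointwise) auto
  also have "\<dots> = K * e + 2 * B * prob (space M - G)"
    using integrable_bad G(1) by (simp add: prob_space)
  also have "\<dots> \<le> K * e + 2 * B * e"
    using G(2) B_nonneg by (intro add_left_mono mult_left_mono) auto
  finally show ?thesis by (simp add: algebra_simps)
qed

theorem converging_together:
  assumes M: "prob_space M" and N: "prob_space N"
    and X: "\<And>j n. random_element E d M (X j n)" and Y: "\<And>n. random_element E d M (Y n)"
    and V: "random_element E d N V"
    and X_tendsto: "\<And>j. converges_weakly E d M (X j) N (Z j)"
    and Z_tendsto: "converges_weakly E d N Z N V"
    and close: "\<And>e. 0 < e \<Longrightarrow> \<forall>\<^sub>F j in sequentially.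
      \<forall>\<^sub>F n in sequentially. close_in_prob d e M (X j n) (Y n)"
  shows "converges_weakly E d M Y N V"
proof (rule converges_weakly_if_lipschitz[OF M N Y V])
  fix g K B assume g: "lipschitz_functional E d K g" and B: "\<And>x. x \<in> E \<Longrightarrow> \<bar>g x\<bar> \<le> B"
  note cont = lipschitz_functional_continuous[OF g]
  obtain \<omega>\<^sub>0 where "\<omega>\<^sub>0 \<in> space N" using prob_space.not_empty[OF N] by auto
  then have "0 \<le> B"
    using B[OF random_element_mem[OF V]] abs_ge_zero order_trans by blast
  then have C: "0 < K + 2 * B + 1" using g by (simp add: lipschitz_functional_def)
  show "(\<lambda>n. \<integral>\<omega>. g (Y n \<omega>) \<partial>M) \<longlonglongrightarrow> (\<integral>\<omega>. g (V \<omega>) \<partial>N)"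
  proof (rule tendstoI)
    fix e :: real assume e: "0 < e"
    define \<eta> where "\<eta> = e / 3 / (K + 2 * B + 1)"
    have \<eta>: "0 < \<eta>" "(K + 2 * B) * \<eta> \<le> e / 3"
      using C e by (auto simp: \<eta>_def field_simps)
    have "\<forall>\<^sub>F j in sequentially. dist (\<integral>\<omega>. g (Z j \<omega>) \<partial>N) (\<integral>\<omega>. g (V \<omega>) \<partial>N) < e / 3"
      using e by (intro tendstoD[OF converges_weaklyD[OF Z_tendsto cont B]]) auto
    from eventually_happens'[OF sequentially_bot eventually_conj[OF close[OF \<eta>(1)] this]] obtain j
      where j: "\<forall>\<^sub>F n in sequentially. close_in_prob d \<eta> M (X j n) (Y n)"
        and Z_V: "dist (\<integral>\<omega>. g (Z j \<omega>) \<partial>N) (\<integral>\<omega>. g (V \<omega>) \<partial>N) < e / 3"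
      by blast
    have "\<forall>\<^sub>F n in sequentially. dist (\<integral>\<omega>. g (X j n \<omega>) \<partial>M) (\<integral>\<omega>. g (Z j \<omega>) \<partial>N) < e / 3"
      using e by (intro tendstoD[OF converges_weaklyD[OF X_tendsto cont B]]) auto
    with j show "\<forall>\<^sub>F n in sequentially. dist (\<integral>\<omega>. g (Y n \<omega>) \<partial>M) (\<integral>\<omega>. g (V \<omega>) \<partial>N) < e"
    proof eventually_elim
      case (elim n)
      have "dist (\<integral>\<omega>. g (X j n \<omega>) \<partial>M) (\<integral>\<omega>. g (Y n \<omega>) \<partial>M) \<le> e / 3"
        using expectation_diff_le_if_close_in_prob[OF M X Y g B elim(1)] \<eta>(2)
        by (simp add: dist_real_def)
      with elim(2) Z_V show ?case unfolding dist_real_def by linarith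
    qed
  qed
qed

end

section \<open>Paths in the Skorokhod space\<close>

lemma D01_one_sided_limits:
  assumes x: "x \<in> D01" and s: "s \<in> {0..1}"
  obtains l r where "(x \<longlongrightarrow> l) (at s within {0..<s})" "(x \<longlongrightarrow> r) (at s within {s<..1})"
proof -
  have "\<exists>l. (x \<longlongrightarrow> l) (at s within {0..<s})"
  proof (cases "0 < s")
    case True
    with x s have "\<exists>l. (x \<longlongrightarrow> l) (at_left s)"
      by (simp add: D01_def cadlag01_def)
    then obtain l where "(x \<longlongrightarrow> l) (at_left s)" ..
    then have "(x \<longlongrightarrow> l) (at s within {0..<s})" by (rule tendsto_within_subset) auto
    then show ?thesis ..
  qed (use s in auto)
  moreover have "\<exists>r. (x \<longlongrightarrow> r) (at s within {s<..1})"
  proof (cases "s < 1")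
    case True
    then have "(x \<longlongrightarrow> x s) (at_right s)"
      using x s by (auto simp: D01_def cadlag01_def continuous_within)
    then have "(x \<longlongrightarrow> x s) (at s within {s<..1})" by (rule tendsto_within_subset) auto
    then show ?thesis ..
  qed (use s in auto)
  ultimately show thesis using that by blast
qed

lemma D01_locally_near_limits:
  assumes x: "x \<in> D01" and s: "s \<in> {0..1}" and e: "0 < e"
  obtains \<delta> l r where "0 < \<delta>"
    "\<forall>u\<in>{0..1} \<inter> {s - \<delta><..<s}. \<bar>x u - l\<bar> < e"
    "\<forall>u\<in>{0..1} \<inter> {s<..<s + \<delta>}. \<bar>x u - r\<bar> < e"
proof -
  obtain l r where lim: "(x \<longlongrightarrow> l) (at s within {0..<s})" "(x \<longlongrightarrow> r) (at s within {s<..1})"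
    using D01_one_sided_limits[OF x s] by blast
  obtain \<delta>1 where "0 < \<delta>1" "\<And>u. \<lbrakk>u \<in> {0..<s}; dist u s < \<delta>1\<rbrakk> \<Longrightarrow> dist (x u) l < e"
    using tendstoD[OF lim(1) e] by (auto simp: eventually_at)
  moreover obtain \<delta>2 where "0 < \<delta>2" "\<And>u. \<lbrakk>u \<in> {s<..1}; dist u s < \<delta>2\<rbrakk> \<Longrightarrow> dist (x u) r < e"
    using tendstoD[OF lim(2) e] by (auto simp: eventually_at)
  ultimately show thesis
    by (intro that[of "min \<delta>1 \<delta>2" l r]) (auto simp: dist_real_def)
qed

lemma D01_bounded:
  assumes "x \<in> D01" obtains B where "\<And>t. t \<in> {0..1} \<Longrightarrow> \<bar>x t\<bar> \<le> B"
proof -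
  have "bounded (x ` ({0..1} \<inter> {0..1}))"
    using zero_le_one[where 'a = real]
  proof (induction rule: Bolzano[where P = "\<lambda>a b. bounded (x ` ({a..b} \<inter> {0..1}))"])
    case (trans a b c)
    then have "{a..c} \<inter> {0..1} = {a..b} \<inter> {0..1} \<union> {b..c} \<inter> {0..1}" by auto
    with trans show ?case by (simp add: image_Un)
  next
    case (local s)
    then have "s \<in> {0..1}" by simp
    then obtain \<delta> l r where \<delta>: "0 < \<delta>"
      "\<forall>u\<in>{0..1} \<inter> {s - \<delta><..<s}. \<bar>x u - l\<bar> < 1"
      "\<forall>u\<in>{0..1} \<inter> {s<..<s + \<delta>}. \<bar>x u - r\<bar> < 1"
      by (rule D01_locally_near_limits[OF assms _ zero_less_one])
    have "bounded (x ` ({a..b} \<inter> {0..1}))" if "a \<le> s \<and> s \<le> b \<and> b - a < \<delta>" for a b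
      unfolding bounded_real
    proof (intro exI[of _ "max \<bar>x s\<bar> (max \<bar>l\<bar> \<bar>r\<bar> + 1)"] ballI)
      fix v assume "v \<in> x ` ({a..b} \<inter> {0..1})"
      then obtain u where u: "v = x u" "u \<in> {a..b}" "u \<in> {0..1}" by auto
      consider "u < s" | "u = s" | "s < u" by linarith
      then show "\<bar>v\<bar> \<le> max \<bar>x s\<bar> (max \<bar>l\<bar> \<bar>r\<bar> + 1)"
        by cases (use u that \<delta>(2)[rule_format, of u] \<delta>(3)[rule_format, of u] in auto)
    qed
    with \<delta>(1) show ?case by blast
  qed
  then obtain B where "\<forall>t\<in>{0..1}. \<bar>x t\<bar> \<le> B" by (auto simp: bounded_real)
  then show thesis using that[of B] by blast
qed

definition oscillates_less_off :: "(real \<Rightarrow> real) \<Rightarrow> real \<Rightarrow> real set \<Rightarrow> real set \<Rightarrow> bool" where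
  "oscillates_less_off x e F A \<longleftrightarrow> (\<forall>u\<in>A. \<forall>v\<in>A. u \<le> v \<and> {u..v} \<inter> F = {} \<longrightarrow> \<bar>x u - x v\<bar> < e)"

lemma oscillates_less_off_Un:
  assumes F: "oscillates_less_off x e F ({a..b} \<inter> I)" and G: "oscillates_less_off x e G ({b..c} \<inter> I)"
  shows "oscillates_less_off x e (insert b (F \<union> G)) ({a..c} \<inter> I)"
  unfolding oscillates_less_off_def
proof (intro ballI impI)
  fix u v
  assume uv: "u \<in> {a..c} \<inter> I" "v \<in> {a..c} \<inter> I" "u \<le> v \<and> {u..v} \<inter> insert b (F \<union> G) = {}"
  then have disjoint: "{u..v} \<inter> F = {}" "{u..v} \<inter> G = {}" and "b \<notin> {u..v}" by blast+
  then consider "v < b" | "b < u" by fastforce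
  then show "\<bar>x u - x v\<bar> < e"
  proof cases
    case 1
    with uv have "u \<in> {a..b} \<inter> I" "v \<in> {a..b} \<inter> I" by auto
    with F uv disjoint show ?thesis by (simp add: oscillates_less_off_def)
  next
    case 2
    with uv have "u \<in> {b..c} \<inter> I" "v \<in> {b..c} \<inter> I" by auto
    with G uv disjoint show ?thesis by (simp add: oscillates_less_off_def)
  qed
qed

lemma D01_oscillates_less_locally:
  assumes "x \<in> D01" and "s \<in> {0..1}" and "0 < e"
  shows "\<exists>\<delta>>0. \<forall>a b. a \<le> s \<and> s \<le> b \<and> b - a < \<delta> \<longrightarrow> oscillates_less_off x e {s} ({a..b} \<inter> {0..1})"
proof -
  obtain \<delta> l r where \<delta>: "0 < \<delta>"
    "\<forall>u\<in>{0..1} \<inter> {s - \<delta><..<s}. \<bar>x u - l\<bar> < e / 2"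
    "\<forall>u\<in>{0..1} \<inter> {s<..<s + \<delta>}. \<bar>x u - r\<bar> < e / 2"
    by (rule D01_locally_near_limits[OF assms(1,2) half_gt_zero[OF assms(3)]])
  have "\<bar>x u - x v\<bar> < e"
    if "a \<le> s \<and> s \<le> b \<and> b - a < \<delta>" "u \<in> {a..b} \<inter> {0..1}" "v \<in> {a..b} \<inter> {0..1}" "u \<le> v" "s \<notin> {u..v}"
    for a b u v
  proof -
    consider "v < s" | "s < u" using \<open>s \<notin> {u..v}\<close> by fastforce
    then show ?thesis
    proof cases
      case 1
      with that have "\<bar>x u - l\<bar> < e / 2" "\<bar>x v - l\<bar> < e / 2" by (intro \<delta>(2)[rule_format]; auto)+
      then show ?thesis by linarith
    next
      case 2
      with that have "\<bar>x u - r\<bar> < e / 2" "\<bar>x v - r\<bar> < e / 2" by (intro \<delta>(3)[rule_format]; auto)+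
      then show ?thesis by linarith
    qed
  qed
  then have "oscillates_less_off x e {s} ({a..b} \<inter> {0..1})" if "a \<le> s \<and> s \<le> b \<and> b - a < \<delta>" for a b
    using that unfolding oscillates_less_off_def by blast
  with \<delta>(1) show ?thesis by blast
qed

lemma D01_oscillation_partition:
  assumes "x \<in> D01" and "0 < e"
  shows "\<exists>F. finite F \<and> oscillates_less_off x e F {0..1}"
proof -
  have "\<exists>F. finite F \<and> oscillates_less_off x e F ({0..1} \<inter> {0..1})"
    using zero_le_one[where 'a = real]
  proof (induction rule:
      Bolzano[where P = "\<lambda>a b. \<exists>F. finite F \<and> oscillates_less_off x e F ({a..b} \<inter> {0..1})"])
    case (trans a b c)
    then show ?case by (meson oscillates_less_off_Un finite.insertI finite_UnI)
  next
    case (local s)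
    then have "s \<in> {0..1}" by simp
    from D01_oscillates_less_locally[OF assms(1) this assms(2)]
    show ?case by (meson finite.emptyI finite.insertI)
  qed
  then show ?thesis by simp
qed

lemma D01_countable_discontinuities:
  assumes "x \<in> D01"
  shows "countable {t \<in> {0<..<1}. \<not> isCont x t}"
proof -
  have "\<exists>F. finite F \<and> oscillates_less_off x (1 / real (Suc m)) F {0..1}" for m
    by (rule D01_oscillation_partition[OF assms]) simp
  then obtain F where F: "\<And>m. finite (F m)"
    "\<And>m. oscillates_less_off x (1 / real (Suc m)) (F m) {0..1}"
    by metis
  have "isCont x t" if t: "t \<in> {0<..<1} - (\<Union>m. F m)" for t
    unfolding continuous_at_eps_delta
  proof (intro allI impI)
    fix e :: real assume "0 < e"
    then obtain m where m: "1 / Suc m < e" using nat_approx_posE by blast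
    have "open ({0<..<1} - F m)" using F(1) by (intro open_Diff finite_imp_closed) auto
    then obtain \<delta> where \<delta>: "0 < \<delta>" "ball t \<delta> \<subseteq> {0<..<1} - F m"
      using t by (elim openE) auto
    have "dist (x u) (x t) < e" if u: "dist u t < \<delta>" for u
    proof -
      have "closed_segment u t \<subseteq> ball t \<delta>"
        using u \<delta>(1) by (intro closed_segment_subset) (auto simp: dist_commute)
      then have segment: "closed_segment u t \<subseteq> {0<..<1} - F m" using \<delta>(2) by blast
      then have "u \<in> {0..1}" "t \<in> {0..1}" by force+
      moreover have "{min u t..max u t} \<inter> F m = {}"
        using segment by (auto simp: closed_segment_eq_real_ivl split: if_splits)
      ultimately have "\<bar>x (min u t) - x (max u t)\<bar> < 1 / Suc m"
        using F(2)[of m] by (simp add: oscillates_less_off_def min_def max_def)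
      then have "\<bar>x u - x t\<bar> < 1 / Suc m"
        by (cases "u \<le> t") (simp_all add: min_def max_def abs_minus_commute)
      with m show ?thesis by (simp add: dist_real_def)
    qed
    with \<delta>(1) show "\<exists>\<delta>>0. \<forall>u. dist u t < \<delta> \<longrightarrow> dist (x u) (x t) < e" by blast
  qed
  then have "{t \<in> {0<..<1}. \<not> isCont x t} \<subseteq> (\<Union>m. F m)" by blast
  moreover have "countable (\<Union>m. F m)"
    by (rule countable_UN) (auto intro: countable_finite F(1))
  ultimately show ?thesis by (rule countable_subset)
qed

lemma D01_AE_isCont:
  assumes "x \<in> D01"
  shows "AE t in lborel. t \<in> {0..1} \<longrightarrow> isCont x t"
proof (rule AE_I')
  show "{t \<in> {0<..<1}. \<not> isCont x t} \<union> {0, 1} \<in> null_sets lborel"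
    using D01_countable_discontinuities[OF assms] by (intro countable_imp_null_set_lborel) auto
qed auto

lemma D01_borel_measurable:
  assumes "x \<in> D01"
  shows "(\<lambda>t. indicator {0..1} t * x t) \<in> borel_measurable borel"
proof (rule borel_measurable_continuous_countable_exceptions)
  let ?X = "{t \<in> {0<..<1}. \<not> isCont x t} \<union> {0, 1}"
  show "countable ?X" using D01_countable_discontinuities[OF assms] by auto
  show "continuous_on (- ?X) (\<lambda>t. indicator {0..1} t * x t)"
  proof (intro continuous_at_imp_continuous_on ballI)
    fix s assume s: "s \<in> - ?X"
    show "isCont (\<lambda>t. indicator {0..1} t * x t) s"
    proof (cases "s \<in> {0<..<1}")
      case True
      with s have "isCont x s" by auto
      have "\<forall>\<^sub>F t in nhds s. indicator {0..1} t * x t = x t"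
        using eventually_nhds_in_open[OF open_greaterThanLessThan True] by eventually_elim auto
      from isCont_cong[OF this] \<open>isCont x s\<close> show ?thesis by blast
    next
      case False
      with s have "s \<in> - {0..1}" by auto
      have "\<forall>\<^sub>F t in nhds s. indicator {0..1} t * x t = 0"
        using eventually_nhds_in_open[OF open_Compl[OF closed_atLeastAtMost] \<open>s \<in> - {0..1}\<close>]
        by eventually_elim auto
      from isCont_cong[OF this] show ?thesis using continuous_const by blast
    qed
  qed
qed

lemma D01_mult_set_integrable:
  assumes x: "x \<in> D01" and w: "w \<in> borel_measurable borel"
    and K: "\<And>s. s \<in> {a..b} \<Longrightarrow> \<bar>w s\<bar> \<le> K" and ab: "{a..b} \<subseteq> {0..1}"
  shows "set_integrable lborel {a..b} (\<lambda>s. x s * w s)"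
proof -
  obtain B where B: "\<And>s. s \<in> {0..1} \<Longrightarrow> \<bar>x s\<bar> \<le> B" using D01_bounded[OF x] by blast
  have "set_integrable lborel {a..b} (\<lambda>s. indicator {0..1} s * x s * w s)"
    unfolding set_integrable_def
  proof (rule integrableI_bounded_set_indicator)
    show "(\<lambda>s. indicator {0..1} s * x s * w s) \<in> borel_measurable lborel"
      using D01_borel_measurable[OF x] w by simp
    show "AE s in lborel. s \<in> {a..b} \<longrightarrow> norm (indicator {0..1} s * x s * w s) \<le> B * K"
    proof (intro AE_I2 impI)
      fix s assume s: "s \<in> {a..b}"
      then have "\<bar>x s\<bar> \<le> B" "\<bar>w s\<bar> \<le> K" "s \<in> {0..1}" using B K ab by auto
      then show "norm (indicator {0..1} s * x s * w s) \<le> B * K"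
        by (auto simp: abs_mult intro!: mult_mono order_trans[OF abs_ge_zero])
    qed
  qed (use emeasure_lborel_Icc_eq in auto)
  also have "?this \<longleftrightarrow> ?thesis"
    using ab by (intro set_integrable_cong) auto
  finally show ?thesis .
qed

lemma D01_set_integrable: "x \<in> D01 \<Longrightarrow> {a..b} \<subseteq> {0..1} \<Longrightarrow> set_integrable lborel {a..b} x"
  using D01_mult_set_integrable[of x "\<lambda>_. 1" a b 1] by simp

lemma continuous_imp_D01:
  assumes x: "continuous_on {0..1} x" shows "x \<in> D01"
proof -
  have within: "(x \<longlongrightarrow> x t) (at t within T)" if "t \<in> {0..1}" "T \<subseteq> {0..1}" for t T
    by (rule tendsto_within_subset[OF x[unfolded continuous_on_def, rule_format, OF that(1)] that(2)])
  have "continuous (at_right t) x" if "t \<in> {0..<1}" for t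
    using within[of t "{t..1}"] that by (simp add: at_within_Icc_at_right continuous_within)
  moreover have "(x \<longlongrightarrow> x t) (at_left t)" if "t \<in> {0<..1}" for t
    using within[of t "{0..t}"] that by (simp add: at_within_Icc_at_left)
  ultimately show ?thesis unfolding D01_def cadlag01_def by blast
qed

lemma D01_compose_continuous:
  fixes h :: "real \<Rightarrow> real"
  assumes x: "x \<in> D01" and h: "continuous_on UNIV h"
  shows "(\<lambda>t. h (x t)) \<in> D01"
proof -
  have h_tendsto: "((\<lambda>t. h (x t)) \<longlongrightarrow> h l) F" if "(x \<longlongrightarrow> l) F" for l F
    using h that by (auto simp: continuous_on_eq_continuous_at intro: isCont_tendsto_compose)
  show ?thesis
    using x h_tendsto unfolding D01_def cadlag01_def continuous_within by blast
qed

definition step_path :: "nat \<Rightarrow> (nat \<Rightarrow> real) \<Rightarrow> real \<Rightarrow> real" where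
  "step_path n z t = z (nat \<lfloor>real n * t\<rfloor>)"

lemma step_path_in_D01: "step_path n z \<in> D01"
proof (cases "n = 0")
  case True
  then show ?thesis by (auto simp: step_path_def intro!: continuous_imp_D01)
next
  case False
  then have n: "0 < real n" by simp
  have right: "\<forall>\<^sub>F u in at_right t. \<lfloor>real n * u\<rfloor> = \<lfloor>real n * t\<rfloor>" for t
  proof (rule eventually_at_rightI)
    show "t < (of_int \<lfloor>real n * t\<rfloor> + 1) / real n"
      using n by (simp add: pos_less_divide_eq mult.commute)
    fix u assume "u \<in> {t<..<(of_int \<lfloor>real n * t\<rfloor> + 1) / real n}"
    then have "real n * t < real n * u" "real n * u < of_int \<lfloor>real n * t\<rfloor> + 1"
      using n by (auto simp: field_simps)
    then show "\<lfloor>real n * u\<rfloor> = \<lfloor>real n * t\<rfloor>" by linarith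
  qed
  have left: "\<forall>\<^sub>F u in at_left t. \<lfloor>real n * u\<rfloor> = \<lceil>real n * t\<rceil> - 1" for t
  proof (rule eventually_at_leftI)
    show "(of_int \<lceil>real n * t\<rceil> - 1) / real n < t"
      using n ceiling_correct[of "real n * t"] by (simp add: pos_divide_less_eq mult.commute)
    fix u assume "u \<in> {(of_int \<lceil>real n * t\<rceil> - 1) / real n<..<t}"
    then have "real n * u < real n * t" "of_int \<lceil>real n * t\<rceil> - 1 < real n * u"
      using n by (auto simp: field_simps)
    then show "\<lfloor>real n * u\<rfloor> = \<lceil>real n * t\<rceil> - 1" by linarith
  qed
  have "(step_path n z \<longlongrightarrow> step_path n z t) (at_right t)"
    and "(step_path n z \<longlongrightarrow> z (nat (\<lceil>real n * t\<rceil> - 1))) (at_left t)" for t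
    unfolding step_path_def
    by (rule tendsto_eventually[OF eventually_mono[OF right]]; simp)
       (rule tendsto_eventually[OF eventually_mono[OF left]]; simp)
  then show ?thesis
    unfolding D01_def cadlag01_def continuous_within by blast
qed

section \<open>Uniform and Skorokhod distance\<close>

definition unif_dist :: "(real \<Rightarrow> real) \<Rightarrow> (real \<Rightarrow> real) \<Rightarrow> real" where
  "unif_dist x y = (SUP t\<in>{0..1}. \<bar>x t - y t\<bar>)"

lemma unif_dist_upper:
  assumes "x \<in> D01" "y \<in> D01" "t \<in> {0..1}"
  shows "\<bar>x t - y t\<bar> \<le> unif_dist x y"
proof -
  obtain Bx By where "\<And>s. s \<in> {0..1} \<Longrightarrow> \<bar>x s\<bar> \<le> Bx" "\<And>s. s \<in> {0..1} \<Longrightarrow> \<bar>y s\<bar> \<le> By"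
    using D01_bounded[OF assms(1)] D01_bounded[OF assms(2)] by metis
  then have "\<bar>x s - y s\<bar> \<le> Bx + By" if "s \<in> {0..1}" for s
    using that abs_triangle_ineq4[of "x s" "y s"] by (meson add_mono order_trans)
  then show ?thesis
    unfolding unif_dist_def by (intro cSUP_upper assms(3) bdd_aboveI2[where M = "Bx + By"])
qed

lemma unif_dist_least: "(\<And>t. t \<in> {0..1} \<Longrightarrow> \<bar>x t - y t\<bar> \<le> r) \<Longrightarrow> unif_dist x y \<le> r"
  unfolding unif_dist_def by (intro cSUP_least) auto

interpretation unif: pseudometric_space D01 unif_dist
proof
  fix x y z assume x: "x \<in> D01" and y: "y \<in> D01"
  show "0 \<le> unif_dist x y"
    using unif_dist_upper[OF x y, of 0] by (simp add: order_trans[OF abs_ge_zero])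
  assume z: "z \<in> D01"
  show "unif_dist x z \<le> unif_dist x y + unif_dist y z"
  proof (rule unif_dist_least)
    fix t :: real assume t: "t \<in> {0..1}"
    show "\<bar>x t - z t\<bar> \<le> unif_dist x y + unif_dist y z"
      using unif_dist_upper[OF x y t] unif_dist_upper[OF y z t] by linarith
  qed
qed (simp_all add: unif_dist_def abs_minus_commute)

definition time_change_cost :: "(real \<Rightarrow> real) \<Rightarrow> (real \<Rightarrow> real) \<Rightarrow> (real \<Rightarrow> real) \<Rightarrow> real" where
  "time_change_cost x y l = max (SUP t\<in>{0..1}. \<bar>l t - t\<bar>) (SUP t\<in>{0..1}. \<bar>x t - y (l t)\<bar>)"

lemma skorokhod_dist_eq_INF: "skorokhod_dist x y = (INF l\<in>skorokhod_Lambda. time_change_cost x y l)"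
  unfolding skorokhod_dist_def time_change_cost_def by (simp add: Setcompr_eq_image)

lemma id_in_skorokhod_Lambda: "id \<in> skorokhod_Lambda"
  by (auto simp: skorokhod_Lambda_def strict_mono_on_def)

lemma skorokhod_Lambda_displacement_le:
  assumes l: "l \<in> skorokhod_Lambda" and t: "t \<in> {0..1}"
  shows "\<bar>l t - t\<bar> \<le> (SUP t\<in>{0..1}. \<bar>l t - t\<bar>)"
proof (rule cSUP_upper[OF t bdd_aboveI2])
  fix s :: real assume s: "s \<in> {0..1}"
  then have "l s \<in> {0..1}" using l by (auto simp: skorokhod_Lambda_def)
  with s show "\<bar>l s - s\<bar> \<le> 1" by auto
qed

lemma time_change_cost_nonneg:
  assumes "l \<in> skorokhod_Lambda" shows "0 \<le> time_change_cost x y l"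
  using order_trans[OF abs_ge_zero skorokhod_Lambda_displacement_le[OF assms, of 0]]
  by (simp add: time_change_cost_def le_max_iff_disj)

lemma skorokhod_dist_nonneg: "0 \<le> skorokhod_dist x y"
  unfolding skorokhod_dist_eq_INF using id_in_skorokhod_Lambda
  by (intro cINF_greatest time_change_cost_nonneg) auto

lemma skorokhod_dist_le_unif_dist:
  assumes "x \<in> D01" "y \<in> D01"
  shows "skorokhod_dist x y \<le> unif_dist x y"
proof -
  have "skorokhod_dist x y \<le> time_change_cost x y id"
    unfolding skorokhod_dist_eq_INF
    by (intro cINF_lower id_in_skorokhod_Lambda bdd_belowI2[where m = 0] time_change_cost_nonneg)
  also have "\<dots> = unif_dist x y"
    using unif.nonneg[OF assms] by (simp add: time_change_cost_def unif_dist_def)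
  finally show ?thesis .
qed

text \<open>Of the time change only surjectivity is kept; this suffices for all integral functionals.\<close>
lemma skorokhod_dist_lessD:
  assumes x: "x \<in> D01" and y: "y \<in> D01" and d: "skorokhod_dist x y < d" and s: "s \<in> {0..1}"
  shows "\<exists>t\<in>{0..1}. \<bar>t - s\<bar> < d \<and> \<bar>x t - y s\<bar> < d"
proof -
  obtain l where l: "l \<in> skorokhod_Lambda" and cost: "time_change_cost x y l < d"
    using cInf_lessD[OF _ d[unfolded skorokhod_dist_eq_INF]] id_in_skorokhod_Lambda by blast
  have l01: "l ` {0..1} = {0..1}" using l by (simp add: skorokhod_Lambda_def)
  with s obtain t where t: "t \<in> {0..1}" "s = l t" by (metis imageE)
  obtain Bx By where B: "\<And>u. u \<in> {0..1} \<Longrightarrow> \<bar>x u\<bar> \<le> Bx" "\<And>u. u \<in> {0..1} \<Longrightarrow> \<bar>y u\<bar> \<le> By"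
    using D01_bounded[OF x] D01_bounded[OF y] by metis
  have "\<bar>x u - y (l u)\<bar> \<le> Bx + By" if "u \<in> {0..1}" for u
    using B(1)[OF that] B(2)[of "l u"] l01 that by (fastforce simp: abs_le_iff)
  then have "\<bar>x t - y (l t)\<bar> \<le> (SUP t\<in>{0..1}. \<bar>x t - y (l t)\<bar>)"
    by (intro cSUP_upper t bdd_aboveI2[where M = "Bx + By"])
  with skorokhod_Lambda_displacement_le[OF l t(1)] cost t show ?thesis
    by (intro bexI[of _ t]) (auto simp: time_change_cost_def)
qed

lemma skorokhod_tendsto_at_isCont:
  assumes x: "x \<in> D01" and y: "\<And>m. y m \<in> D01" and lim: "(\<lambda>m. skorokhod_dist x (y m)) \<longlonglongrightarrow> 0"
    and s: "s \<in> {0..1}" and cont: "isCont x s"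
  shows "(\<lambda>m. y m s) \<longlonglongrightarrow> x s"
proof -
  define d where "d m = skorokhod_dist x (y m) + 1 / Suc m" for m
  have d_0: "d \<longlonglongrightarrow> 0"
    unfolding d_def using tendsto_add[OF lim LIMSEQ_Suc[OF lim_1_over_n]] by simp
  have "\<exists>t\<in>{0..1}. \<bar>t - s\<bar> < d m \<and> \<bar>x t - y m s\<bar> < d m" for m
    unfolding d_def by (rule skorokhod_dist_lessD[OF x y _ s]) simp
  then obtain t where t: "\<And>m. \<bar>t m - s\<bar> < d m" "\<And>m. \<bar>x (t m) - y m s\<bar> < d m" by metis
  have "(\<lambda>m. t m - s) \<longlonglongrightarrow> 0" "(\<lambda>m. x (t m) - y m s) \<longlonglongrightarrow> 0"
    using t by (auto intro!: Lim_null_comparison[OF _ d_0] always_eventually less_imp_le)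
  then have "(\<lambda>m. x (t m)) \<longlonglongrightarrow> x s" "(\<lambda>m. x (t m) - y m s) \<longlonglongrightarrow> 0"
    using isCont_tendsto_compose[OF cont, of t] by (auto simp: LIM_zero_iff)
  from tendsto_diff[OF this] show ?thesis by simp
qed

lemma skorokhod_ball_uniformly_bounded:
  assumes x: "x \<in> D01"
  shows "\<exists>B. \<forall>y\<in>D01. skorokhod_dist x y < d \<longrightarrow> (\<forall>s\<in>{0..1}. \<bar>x s - y s\<bar> \<le> B)"
proof -
  obtain B where B: "\<And>s. s \<in> {0..1} \<Longrightarrow> \<bar>x s\<bar> \<le> B" using D01_bounded[OF x] by blast
  have "\<bar>x s - y s\<bar> \<le> 2 * B + d" if y: "y \<in> D01" "skorokhod_dist x y < d" and s: "s \<in> {0..1}" for y s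
  proof -
    obtain t where "t \<in> {0..1}" "\<bar>x t - y s\<bar> < d"
      using skorokhod_dist_lessD[OF x y s] by blast
    with B[of t] B[OF s] show ?thesis by linarith
  qed
  then show ?thesis by blast
qed

lemma skorokhod_tendsto_L1:
  assumes x: "x \<in> D01" and y: "\<And>m. y m \<in> D01" and lim: "(\<lambda>m. skorokhod_dist x (y m)) \<longlonglongrightarrow> 0"
  shows "(\<lambda>m. LINT s:{0..1}|lborel. \<bar>x s - y m s\<bar>) \<longlonglongrightarrow> 0"
proof -
  have "Bseq (\<lambda>m. skorokhod_dist x (y m))"
    by (rule convergent_imp_Bseq[OF convergentI[OF lim]])
  then obtain C where C: "\<forall>m. norm (skorokhod_dist x (y m)) \<le> C" by (rule BseqE)
  have dist_less: "skorokhod_dist x (y m) < C + 1" for m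
    using spec[OF C, of m] by simp
  obtain B where B: "\<forall>y\<in>D01. skorokhod_dist x y < C + 1 \<longrightarrow> (\<forall>s\<in>{0..1}. \<bar>x s - y s\<bar> \<le> B)"
    using skorokhod_ball_uniformly_bounded[OF x] by blast
  have integrable: "set_integrable lborel {0..1} (\<lambda>s. \<bar>x s - y m s\<bar>)" for m
    using x y by (intro set_integrable_abs set_integral_diff D01_set_integrable) auto
  have "(\<lambda>m. LINT s|lborel. indicator {0..1} s *\<^sub>R \<bar>x s - y m s\<bar>)
      \<longlonglongrightarrow> (LINT s|(lborel :: real measure). 0)"
  proof (rule integral_dominated_convergence[where w = "\<lambda>s::real. indicator {0..1} s * B"])
    show "AE s in lborel. (\<lambda>m. indicator {0..1} s *\<^sub>R \<bar>x s - y m s\<bar>) \<longlonglongrightarrow> 0"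
      using D01_AE_isCont[OF x]
    proof eventually_elim
      case (elim s)
      show ?case
      proof (cases "s \<in> {0..1}")
        case True
        with elim skorokhod_tendsto_at_isCont[OF x y lim True]
        have "(\<lambda>m. x s - y m s) \<longlonglongrightarrow> x s - x s" by (intro tendsto_diff tendsto_const) auto
        with True show ?thesis by (simp add: tendsto_rabs_zero_iff)
      qed simp
    qed
    show "AE s in lborel. norm (indicator {0..1} s *\<^sub>R \<bar>x s - y m s\<bar>) \<le> indicator {0..1} s * B" for m
      using B y dist_less by (intro AE_I2) (auto simp: indicator_def)
    show "(\<lambda>s. indicator {0..1} s *\<^sub>R \<bar>x s - y m s\<bar>) \<in> borel_measurable lborel" for m
      using integrable[of m] by (simp add: set_integrable_def borel_measurable_integrable)
    show "integrable lborel (\<lambda>s::real. indicator {0..1} s * B)"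
      by (intro integrable_mult_left integrable_real_indicator) auto
  qed simp
  then show ?thesis by (simp add: set_lebesgue_integral_def)
qed

lemma skorokhod_continuous_iff: "skorokhod_continuous f \<longleftrightarrow> continuous_functional D01 skorokhod_dist f"
proof
  assume f: "skorokhod_continuous f"
  show "continuous_functional D01 skorokhod_dist f"
    unfolding continuous_functional_iff
  proof (intro ballI impI)
    fix x y assume x: "x \<in> D01" and y: "y \<in> UNIV \<rightarrow> D01" and lim: "(\<lambda>m. skorokhod_dist x (y m)) \<longlonglongrightarrow> 0"
    show "(\<lambda>m. f (y m)) \<longlonglongrightarrow> f x"
    proof (rule tendstoI)
      fix e :: real assume "0 < e"
      with f x obtain \<delta> where \<delta>: "0 < \<delta>" "\<forall>z\<in>D01. skorokhod_dist x z < \<delta> \<longrightarrow> \<bar>f z - f x\<bar> < e"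
        unfolding skorokhod_continuous_def by blast
      from order_tendstoD(2)[OF lim \<delta>(1)] show "\<forall>\<^sub>F m in sequentially. dist (f (y m)) (f x) < e"
        by eventually_elim (use \<delta>(2) y in \<open>auto simp: dist_real_def\<close>)
    qed
  qed
next
  assume f: "continuous_functional D01 skorokhod_dist f"
  show "skorokhod_continuous f"
  proof (rule ccontr)
    assume "\<not> skorokhod_continuous f"
    then obtain x e where x: "x \<in> D01" and e: "0 < e"
      and "\<And>\<delta>. 0 < \<delta> \<Longrightarrow> \<exists>y\<in>D01. skorokhod_dist x y < \<delta> \<and> e \<le> \<bar>f y - f x\<bar>"
      unfolding skorokhod_continuous_def by (meson not_less)
    then have "\<exists>y\<in>D01. skorokhod_dist x y < 1 / real (Suc m) \<and> e \<le> \<bar>f y - f x\<bar>" for m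
      by simp
    then obtain y where y: "\<And>m. y m \<in> D01" "\<And>m. skorokhod_dist x (y m) < 1 / real (Suc m)"
      "\<And>m. e \<le> \<bar>f (y m) - f x\<bar>"
      by metis
    have "(\<lambda>m. skorokhod_dist x (y m)) \<longlonglongrightarrow> 0"
      using skorokhod_dist_nonneg less_imp_le[OF y(2)]
      by (intro tendsto_sandwich[OF _ _ tendsto_const LIMSEQ_Suc[OF lim_1_over_n]]
        always_eventually allI)
    with f x y(1) have "(\<lambda>m. f (y m)) \<longlonglongrightarrow> f x" by (auto simp: continuous_functional_iff)
    from tendstoD[OF this e] y(3) show False
      by (auto simp: eventually_sequentially dist_real_def not_less[symmetric])
  qed
qed

lemma conv_distr_D_iff_converges_weakly:
  assumes X: "\<And>n. random_element D01 skorokhod_dist M (X n)"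
    and Y: "random_element D01 skorokhod_dist N Y"
  shows "conv_distr_D M X N Y \<longleftrightarrow> converges_weakly D01 skorokhod_dist M X N Y"
proof -
  have completion_integrals: "integral\<^sup>L (completion M) (\<lambda>\<omega>. f (X n \<omega>)) = (\<integral>\<omega>. f (X n \<omega>) \<partial>M)"
    "integral\<^sup>L (completion N) (\<lambda>\<omega>. f (Y \<omega>)) = (\<integral>\<omega>. f (Y \<omega>) \<partial>N)"
    if "continuous_functional D01 skorokhod_dist f" for f n
    by (rule integral_completion[OF random_element_measurable[OF X that]],
        rule integral_completion[OF random_element_measurable[OF Y that]])
  have "AE \<omega> in M. X n \<omega> \<in> D01" "AE \<omega> in N. Y \<omega> \<in> D01" for n
    by (auto intro!: AE_I2 random_element_mem[OF X] random_element_mem[OF Y])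
  then show ?thesis
    unfolding conv_distr_D_def converges_weakly_def skorokhod_continuous_iff
    using completion_integrals by auto
qed

lemma conv_distr_D_cong:
  assumes conv: "conv_distr_D M X N Y" and eq: "\<And>n \<omega>. \<omega> \<in> space M \<Longrightarrow> X n \<omega> = X' n \<omega>"
  shows "conv_distr_D M X' N Y"
  unfolding conv_distr_D_def
proof (intro conjI allI impI)
  have "(AE \<omega> in M. X n \<omega> \<in> D01) \<longleftrightarrow> (AE \<omega> in M. X' n \<omega> \<in> D01)" for n
    using eq by (intro AE_cong) simp
  with conv show "AE \<omega> in M. X' n \<omega> \<in> D01" "AE \<omega> in N. Y \<omega> \<in> D01" for n
    by (auto simp: conv_distr_D_def)
  fix f assume "skorokhod_continuous f \<and> (\<exists>B. \<forall>x\<in>D01. \<bar>f x\<bar> \<le> B)"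
  with conv have "(\<lambda>n. \<integral>\<omega>. f (X n \<omega>) \<partial>completion M) \<longlonglongrightarrow> (\<integral>\<omega>. f (Y \<omega>) \<partial>completion N)"
    by (simp add: conv_distr_D_def)
  also have "(\<lambda>n. \<integral>\<omega>. f (X n \<omega>) \<partial>completion M) = (\<lambda>n. \<integral>\<omega>. f (X' n \<omega>) \<partial>completion M)"
    using eq by (intro ext Bochner_Integration.integral_cong) simp_all
  finally show "(\<lambda>n. \<integral>\<omega>. f (X' n \<omega>) \<partial>completion M) \<longlonglongrightarrow> (\<integral>\<omega>. f (Y \<omega>) \<partial>completion N)" .
qed

lemma id_unif_skorokhod_continuous: "seq_continuous D01 unif_dist D01 skorokhod_dist (\<lambda>x. x)"
  unfolding seq_continuous_def
proof (intro conjI ballI impI)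
  fix x y assume x: "x \<in> D01" and y: "y \<in> UNIV \<rightarrow> D01" and lim: "(\<lambda>m. unif_dist x (y m)) \<longlonglongrightarrow> 0"
  show "(\<lambda>m. skorokhod_dist x (y m)) \<longlonglongrightarrow> 0"
    using x y by (intro tendsto_sandwich[OF _ _ tendsto_const lim])
      (auto intro!: always_eventually skorokhod_dist_nonneg skorokhod_dist_le_unif_dist)
qed simp

lemma pointwise_map_unif_continuous:
  assumes h: "continuous_on UNIV (h :: real \<Rightarrow> real)"
  shows "seq_continuous D01 unif_dist D01 unif_dist (\<lambda>x t. h (x t))"
  unfolding seq_continuous_def
proof (intro conjI funcsetI ballI impI)
  fix x y assume x: "x \<in> D01" and y: "y \<in> UNIV \<rightarrow> D01" and lim: "(\<lambda>m. unif_dist x (y m)) \<longlonglongrightarrow> 0"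
  obtain B where B: "\<And>t. t \<in> {0..1} \<Longrightarrow> \<bar>x t\<bar> \<le> B" using D01_bounded[OF x] by blast
  show "(\<lambda>m. unif_dist (\<lambda>t. h (x t)) (\<lambda>t. h (y m t))) \<longlonglongrightarrow> 0"
  proof (rule tendstoI)
    fix e :: real assume e: "0 < e"
    have "uniformly_continuous_on {-B-1..B+1} h"
      by (intro compact_uniformly_continuous continuous_on_subset[OF h]) auto
    then obtain \<delta> where \<delta>: "0 < \<delta>"
      "\<And>a b. \<lbrakk>a \<in> {-B-1..B+1}; b \<in> {-B-1..B+1}; dist b a < \<delta>\<rbrakk> \<Longrightarrow> dist (h b) (h a) < e / 2"
      using e unfolding uniformly_continuous_on_def by (metis half_gt_zero)
    have "\<forall>\<^sub>F m in sequentially. unif_dist x (y m) < min 1 \<delta>"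
      using \<delta>(1) by (intro order_tendstoD(2)[OF lim]) simp
    then show "\<forall>\<^sub>F m in sequentially. dist (unif_dist (\<lambda>t. h (x t)) (\<lambda>t. h (y m t))) 0 < e"
    proof eventually_elim
      case (elim m)
      have "unif_dist (\<lambda>t. h (x t)) (\<lambda>t. h (y m t)) \<le> e / 2"
      proof (rule unif_dist_least)
        fix t :: real assume t: "t \<in> {0..1}"
        have "y m \<in> D01" using y by auto
        from unif_dist_upper[OF x this t] elim have "\<bar>x t - y m t\<bar> < 1" "\<bar>x t - y m t\<bar> < \<delta>" by auto
        with B[OF t] have "dist (h (x t)) (h (y m t)) < e / 2"
          by (intro \<delta>(2)) (auto simp: dist_real_def)
        then show "\<bar>h (x t) - h (y m t)\<bar> \<le> e / 2" by (simp add: dist_real_def)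
      qed
      moreover have "0 \<le> unif_dist (\<lambda>t. h (x t)) (\<lambda>t. h (y m t))"
        by (rule unif.nonneg; rule D01_compose_continuous[OF _ h]) (use x y in auto)
      ultimately show ?case using e by simp
    qed
  qed
qed (rule D01_compose_continuous[OF _ h])

lemma random_element_skorokhod_if_unif:
  "random_element D01 unif_dist M X \<Longrightarrow> random_element D01 skorokhod_dist M X"
  using random_element_compose[OF _ id_unif_skorokhod_continuous] .

section \<open>Random paths\<close>

lemma step_path_functional_continuous:
  assumes g: "continuous_functional D01 unif_dist g"
  shows "continuous_on UNIV (\<lambda>z. g (step_path n z))"
  unfolding continuous_on_eq_continuous_within
proof (intro ballI continuous_within_sequentiallyI)
  fix z and u :: "nat \<Rightarrow> nat \<Rightarrow> real" assume u: "u \<longlonglongrightarrow> z"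
  have coordinate: "(\<lambda>m. u m k) \<longlonglongrightarrow> z k" for k
    by (rule continuous_on_tendsto_compose[OF continuous_on_product_coordinates u]) auto
  have "(\<lambda>m. unif_dist (step_path n z) (step_path n (u m))) \<longlonglongrightarrow> 0"
  proof (rule tendsto_sandwich[OF _ _ tendsto_const])
    show "(\<lambda>m. \<Sum>k\<le>n. \<bar>z k - u m k\<bar>) \<longlonglongrightarrow> 0"
      using coordinate by (auto intro!: tendsto_eq_intros)
    have "unif_dist (step_path n z) (step_path n (u m)) \<le> (\<Sum>k\<le>n. \<bar>z k - u m k\<bar>)" for m
    proof (rule unif_dist_least)
      fix t :: real assume "t \<in> {0..1}"
      then have "real n * t \<le> real n" by (simp add: mult_left_le)
      then have "nat \<lfloor>real n * t\<rfloor> \<in> {..n}" by (simp add: nat_le_iff floor_le_iff)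
      then show "\<bar>step_path n z t - step_path n (u m) t\<bar> \<le> (\<Sum>k\<le>n. \<bar>z k - u m k\<bar>)"
        unfolding step_path_def by (intro member_le_sum) auto
    qed
    then show "\<forall>\<^sub>F m in sequentially. unif_dist (step_path n z) (step_path n (u m))
        \<le> (\<Sum>k\<le>n. \<bar>z k - u m k\<bar>)"
      by simp
  qed (simp add: unif.nonneg step_path_in_D01)
  then show "(\<lambda>m. g (step_path n (u m))) \<longlonglongrightarrow> g (step_path n z)"
    using g by (simp add: continuous_functional_iff step_path_in_D01)
qed

lemma random_element_step_path:
  assumes "\<And>k. z k \<in> borel_measurable M"
  shows "random_element D01 unif_dist M (\<lambda>\<omega>. step_path n (\<lambda>k. z k \<omega>))"
  unfolding random_element_def
proof (intro conjI funcsetI allI impI)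
  fix g assume "continuous_functional D01 unif_dist g"
  then have "(\<lambda>z. g (step_path n z)) \<in> borel_measurable borel"
    by (intro borel_measurable_continuous_onI step_path_functional_continuous)
  moreover have "(\<lambda>\<omega> k. z k \<omega>) \<in> borel_measurable M"
    by (rule measurable_coordinatewise_then_product) (rule assms)
  ultimately show "(\<lambda>\<omega>. g (step_path n (\<lambda>k. z k \<omega>))) \<in> borel_measurable M"
    by (rule measurable_compose[rotated])
qed (rule step_path_in_D01)

lemma grid_point_in_unit_interval:
  assumes "0 < n" "t \<in> {0..1}"
  shows "real (nat \<lfloor>real n * t\<rfloor>) / real n \<in> {0..1}"
proof -
  have "0 \<le> real n * t" "real n * t \<le> real n" using assms by (auto simp: mult_left_le)
  then have "real (nat \<lfloor>real n * t\<rfloor>) \<le> real n" by linarith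
  then show ?thesis using assms(1) by simp
qed

lemma grid_point_close:
  assumes "0 < n" "0 \<le> t"
  shows "\<bar>t - real (nat \<lfloor>real n * t\<rfloor>) / real n\<bar> \<le> 1 / real n"
proof -
  have "0 \<le> real n * t" using assms by simp
  then have "\<bar>real n * t - real (nat \<lfloor>real n * t\<rfloor>)\<bar> \<le> 1" by linarith
  then have "\<bar>real n * t - real (nat \<lfloor>real n * t\<rfloor>)\<bar> / real n \<le> 1 / real n"
    by (simp add: divide_right_mono)
  moreover have "t - real (nat \<lfloor>real n * t\<rfloor>) / real n =
      (real n * t - real (nat \<lfloor>real n * t\<rfloor>)) / real n"
    using assms(1) by (simp add: field_simps)
  ultimately show ?thesis by simp
qed

lemma step_path_interpolation_tendsto:
  assumes x: "continuous_on {0..1} x"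
  shows "(\<lambda>m. unif_dist x (step_path (Suc m) (\<lambda>k. x (real k / real (Suc m))))) \<longlonglongrightarrow> 0"
proof (rule tendstoI)
  fix e :: real assume e: "0 < e"
  have "uniformly_continuous_on {0..1} x"
    by (intro compact_uniformly_continuous x) simp
  then obtain \<delta> where \<delta>: "0 < \<delta>"
    "\<And>s t. \<lbrakk>s \<in> {0..1}; t \<in> {0..1}; dist t s < \<delta>\<rbrakk> \<Longrightarrow> dist (x t) (x s) < e / 2"
    using e unfolding uniformly_continuous_on_def by (metis half_gt_zero)
  from order_tendstoD(2)[OF LIMSEQ_Suc[OF lim_1_over_n] \<delta>(1)]
  show "\<forall>\<^sub>F m in sequentially. dist (unif_dist x (step_path (Suc m) (\<lambda>k. x (real k / real (Suc m))))) 0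
      < e"
  proof eventually_elim
    case (elim m)
    let ?step = "step_path (Suc m) (\<lambda>k. x (real k / real (Suc m)))"
    have "unif_dist x ?step \<le> e / 2"
    proof (rule unif_dist_least)
      fix t :: real assume t: "t \<in> {0..1}"
      then have "0 \<le> t" by simp
      from le_less_trans[OF grid_point_close[OF zero_less_Suc this] elim]
      have "dist t (real (nat \<lfloor>real (Suc m) * t\<rfloor>) / real (Suc m)) < \<delta>"
        by (simp only: dist_real_def)
      from \<delta>(2)[OF grid_point_in_unit_interval[OF zero_less_Suc t] t this]
      show "\<bar>x t - ?step t\<bar> \<le> e / 2"
        by (simp only: step_path_def dist_real_def less_imp_le)
    qed
    moreover have "0 \<le> unif_dist x ?step"
      by (intro unif.nonneg continuous_imp_D01 x step_path_in_D01)
    ultimately show ?case using e by simp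
  qed
qed

lemma random_element_continuous_path:
  assumes X_cont: "\<And>\<omega>. \<omega> \<in> space M \<Longrightarrow> continuous_on {0..1} (X \<omega>)"
    and X_measurable: "\<And>t. 0 \<le> t \<Longrightarrow> (\<lambda>\<omega>. X \<omega> t) \<in> borel_measurable M"
  shows "random_element D01 unif_dist M X"
proof (rule random_element_limit)
  show "random_element D01 unif_dist M
      (\<lambda>\<omega>. step_path (Suc m) (\<lambda>k. X \<omega> (real k / real (Suc m))))" for m
    by (rule random_element_step_path) (simp add: X_measurable)
qed (rule continuous_imp_D01 step_path_interpolation_tendsto; erule X_cont)+

section \<open>Integration against \<open>ds / s\<close>\<close>

definition div_integral :: "real \<Rightarrow> (real \<Rightarrow> real) \<Rightarrow> real \<Rightarrow> real" where
  "div_integral \<epsilon> x t = (LINT s:{\<epsilon>..t}|lborel. x s / s)"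

lemma set_integral_continuous_on:
  fixes h :: "real \<Rightarrow> real"
  assumes "set_integrable lborel {a..b} h"
  shows "continuous_on {a..b} (\<lambda>t. LINT s:{a..t}|lborel. h s)"
proof -
  have "continuous_on {a..b} (\<lambda>t. integral {a..t} h)"
    by (intro indefinite_integral_continuous_1 set_borel_integral_eq_integral(1) assms)
  also have "?this \<longleftrightarrow> ?thesis"
  proof (rule continuous_on_cong[OF refl])
    fix t assume "t \<in> {a..b}"
    then have "set_integrable lborel {a..t} h" by (intro set_integrable_subset[OF assms]) auto
    then show "integral {a..t} h = (LINT s:{a..t}|lborel. h s)"
      by (simp add: set_borel_integral_eq_integral)
  qed
  finally show ?thesis .
qed

lemma D01_div_set_integrable:
  assumes "x \<in> D01" and "0 < \<epsilon>" and "t \<le> 1"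
  shows "set_integrable lborel {\<epsilon>..t} (\<lambda>s. x s / s)"
proof -
  have "\<bar>inverse s\<bar> \<le> inverse \<epsilon>" if "s \<in> {\<epsilon>..t}" for s
    using that assms(2) by (auto intro: le_imp_inverse_le)
  then show ?thesis
    using assms unfolding divide_inverse
    by (intro D01_mult_set_integrable[where K = "inverse \<epsilon>"]) auto
qed

lemma div_integral_continuous:
  assumes x: "x \<in> D01" and \<epsilon>: "0 < \<epsilon>"
  shows "continuous_on {0..1} (div_integral \<epsilon> x)"
proof -
  have "indicator {0..1} s *\<^sub>R (indicator {\<epsilon>..1} s * (x s / s)) = indicator {\<epsilon>..1} s *\<^sub>R (x s / s)" for s
    using \<epsilon> by (simp add: indicator_def)
  then have "set_integrable lborel {0..1} (\<lambda>s. indicator {\<epsilon>..1} s * (x s / s))"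
    using D01_div_set_integrable[OF x \<epsilon> order_refl] by (simp only: set_integrable_def)
  from set_integral_continuous_on[OF this] show ?thesis
  proof (rule continuous_on_eq)
    fix t :: real assume "t \<in> {0..1}"
    then show "(LINT s:{0..t}|lborel. indicator {\<epsilon>..1} s * (x s / s)) = div_integral \<epsilon> x t"
      unfolding div_integral_def set_lebesgue_integral_def
      using \<epsilon> by (intro Bochner_Integration.integral_cong) (auto simp: indicator_def)
  qed
qed

lemma div_integral_in_D01: "x \<in> D01 \<Longrightarrow> 0 < \<epsilon> \<Longrightarrow> div_integral \<epsilon> x \<in> D01"
  by (rule continuous_imp_D01[OF div_integral_continuous])

text \<open>Where \<open>x s / s\<close> is not integrable at 0, the integral has the junk value 0 for all positive \<open>t\<close>.\<close>
lemma div_integral_0_continuous: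
  assumes x: "x \<in> D01"
  shows "continuous_on {0..1} (div_integral 0 x)"
proof (cases "set_integrable lborel {0..1} (\<lambda>s. x s / s)")
  case True
  then show ?thesis unfolding div_integral_def by (rule set_integral_continuous_on)
next
  case False
  have "div_integral 0 x t = 0" if t: "t \<in> {0..1}" for t
  proof (cases "t = 0")
    case True
    have "div_integral 0 x 0 = (LINT s:{0..0::real}|lborel. 0)"
      unfolding div_integral_def by (intro set_lebesgue_integral_cong) auto
    with True show ?thesis by simp
  next
    case t_pos: False
    have "\<not> set_integrable lborel {0..t} (\<lambda>s. x s / s)"
    proof
      assume "set_integrable lborel {0..t} (\<lambda>s. x s / s)"
      moreover have "set_integrable lborel {t..1} (\<lambda>s. x s / s)"
        using t t_pos by (intro D01_div_set_integrable x) auto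
      ultimately have "set_integrable lborel ({0..t} \<union> {t..1}) (\<lambda>s. x s / s)"
        by (rule set_integrable_Un) auto
      with False t show False by (simp add: ivl_disj_un_two_touch)
    qed
    then show ?thesis
      by (simp add: div_integral_def set_lebesgue_integral_def set_integrable_def
        not_integrable_integral_eq)
  qed
  then have "continuous_on {0..1} (div_integral 0 x) \<longleftrightarrow> continuous_on {0..1::real} (\<lambda>_. 0 :: real)"
    by (intro continuous_on_cong) auto
  then show ?thesis by simp
qed

lemma unif_dist_div_integral_le:
  assumes x: "x \<in> D01" and y: "y \<in> D01" and \<epsilon>: "0 < \<epsilon>"
  shows "unif_dist (div_integral \<epsilon> x) (div_integral \<epsilon> y) \<le> (LINT s:{0..1}|lborel. \<bar>x s - y s\<bar>) / \<epsilon>"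
proof (rule unif_dist_least)
  fix t :: real assume t: "t \<in> {0..1}"
  have integrable: "set_integrable lborel {\<epsilon>..t} (\<lambda>s. x s / s)"
    "set_integrable lborel {\<epsilon>..t} (\<lambda>s. y s / s)"
    using t by (auto intro!: D01_div_set_integrable x y \<epsilon>)
  have "set_integrable lborel {0..1} (\<lambda>s. \<bar>x s - y s\<bar> / \<epsilon>)"
    by (intro set_integrable_divide set_integrable_abs set_integral_diff D01_set_integrable x y) auto
  moreover have "norm (indicator {\<epsilon>..t} s *\<^sub>R (x s / s - y s / s))
      \<le> indicator {0..1} s *\<^sub>R (\<bar>x s - y s\<bar> / \<epsilon>)" for s
    using t \<epsilon> by (auto simp: indicator_def diff_divide_distrib[symmetric] abs_divide
        intro!: divide_left_mono mult_pos_pos)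
  ultimately have "norm (LINT s:{\<epsilon>..t}|lborel. x s / s - y s / s)
      \<le> (LINT s:{0..1}|lborel. \<bar>x s - y s\<bar> / \<epsilon>)"
    using set_integral_diff(1)[OF integrable] unfolding set_lebesgue_integral_def set_integrable_def
    by (rule Bochner_Integration.integral_norm_bound_integral[rotated])
  then show "\<bar>div_integral \<epsilon> x t - div_integral \<epsilon> y t\<bar> \<le> (LINT s:{0..1}|lborel. \<bar>x s - y s\<bar>) / \<epsilon>"
    using integrable by (simp add: div_integral_def set_integral_diff)
qed

lemma div_integral_seq_continuous:
  assumes \<epsilon>: "0 < \<epsilon>"
  shows "seq_continuous D01 skorokhod_dist D01 unif_dist (div_integral \<epsilon>)"
  unfolding seq_continuous_def
proof (intro conjI funcsetI ballI impI)
  fix x y assume x: "x \<in> D01" and y: "y \<in> UNIV \<rightarrow> D01" and lim: "(\<lambda>m. skorokhod_dist x (y m)) \<longlonglongrightarrow> 0"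
  then have y': "y m \<in> D01" for m by auto
  show "(\<lambda>m. unif_dist (div_integral \<epsilon> x) (div_integral \<epsilon> (y m))) \<longlonglongrightarrow> 0"
  proof (rule tendsto_sandwich[OF _ _ tendsto_const])
    show "(\<lambda>m. (LINT s:{0..1}|lborel. \<bar>x s - y m s\<bar>) / \<epsilon>) \<longlonglongrightarrow> 0"
      using tendsto_divide[OF skorokhod_tendsto_L1[OF x y' lim] tendsto_const[of \<epsilon>]] \<epsilon> by simp
    show "\<forall>\<^sub>F m in sequentially. 0 \<le> unif_dist (div_integral \<epsilon> x) (div_integral \<epsilon> (y m))"
      by (intro always_eventually allI unif.nonneg div_integral_in_D01 x y' \<epsilon>)
    show "\<forall>\<^sub>F m in sequentially. unif_dist (div_integral \<epsilon> x) (div_integral \<epsilon> (y m))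
        \<le> (LINT s:{0..1}|lborel. \<bar>x s - y m s\<bar>) / \<epsilon>"
      by (intro always_eventually allI unif_dist_div_integral_le x y' \<epsilon>)
  qed
qed (rule div_integral_in_D01[OF _ \<epsilon>])

lemma unif_dist_div_integral_0_le:
  assumes x: "x \<in> D01" and integrable: "set_integrable lborel {0..1} (\<lambda>s. x s / s)"
    and \<epsilon>: "\<epsilon> \<in> {0<..1}"
  shows "unif_dist (div_integral 0 x) (div_integral \<epsilon> x) \<le> (LINT s:{0..\<epsilon>}|lborel. \<bar>x s / s\<bar>)"
proof (rule unif_dist_least)
  fix t :: real assume t: "t \<in> {0..1}"
  have int: "set_integrable lborel A (\<lambda>s. x s / s)" if "A \<in> sets borel" "A \<subseteq> {0..1}" for A
    by (rule set_integrable_subset[OF integrable]) (use that in auto)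
  have "norm (indicator {0..t} s *\<^sub>R (x s / s) - indicator {\<epsilon>..t} s *\<^sub>R (x s / s))
      \<le> indicator {0..\<epsilon>} s *\<^sub>R \<bar>x s / s\<bar>" for s
    using \<epsilon> by (auto simp: indicator_def)
  moreover have "integrable lborel (\<lambda>s. indicator {0..\<epsilon>} s *\<^sub>R \<bar>x s / s\<bar>)"
    using set_integrable_abs[OF int[of "{0..\<epsilon>}"]] \<epsilon> by (simp add: set_integrable_def)
  moreover have parts: "integrable lborel (\<lambda>s. indicator {0..t} s *\<^sub>R (x s / s))"
    "integrable lborel (\<lambda>s. indicator {\<epsilon>..t} s *\<^sub>R (x s / s))"
    using int[of "{0..t}"] int[of "{\<epsilon>..t}"] t \<epsilon> by (simp_all add: set_integrable_def)
  ultimately have "norm (LINT s|lborel. indicator {0..t} s *\<^sub>R (x s / s)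
      - indicator {\<epsilon>..t} s *\<^sub>R (x s / s))
      \<le> (LINT s:{0..\<epsilon>}|lborel. \<bar>x s / s\<bar>)"
    unfolding set_lebesgue_integral_def
    by (intro Bochner_Integration.integral_norm_bound_integral Bochner_Integration.integrable_diff)
  with parts show "\<bar>div_integral 0 x t - div_integral \<epsilon> x t\<bar> \<le> (LINT s:{0..\<epsilon>}|lborel. \<bar>x s / s\<bar>)"
    by (simp add: div_integral_def set_lebesgue_integral_def)
qed

lemma div_integral_tendsto:
  assumes x: "x \<in> D01" and integrable: "set_integrable lborel {0..1} (\<lambda>s. x s / s)"
    and \<epsilon>: "\<And>j. \<epsilon> j \<in> {0<..1}" "\<epsilon> \<longlonglongrightarrow> 0"
  shows "(\<lambda>j. unif_dist (div_integral 0 x) (div_integral (\<epsilon> j) x)) \<longlonglongrightarrow> 0"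
proof (rule tendsto_sandwich[OF _ _ tendsto_const])
  have "continuous_on {0..1} (\<lambda>t. LINT s:{0..t}|lborel. \<bar>x s / s\<bar>)"
    by (intro set_integral_continuous_on set_integrable_abs integrable)
  moreover have "\<epsilon> j \<in> {0..1}" for j using \<epsilon>(1)[of j] by auto
  ultimately have "(\<lambda>j. LINT s:{0..\<epsilon> j}|lborel. \<bar>x s / s\<bar>) \<longlonglongrightarrow> (LINT s:{0..0}|lborel. \<bar>x s / s\<bar>)"
    by (intro continuous_on_tendsto_compose[OF _ \<epsilon>(2)] always_eventually) auto
  also have "(LINT s:{0..0}|lborel. \<bar>x s / s\<bar>) = (LINT s:{0..0::real}|lborel. 0)"
    by (intro set_lebesgue_integral_cong) auto
  finally show "(\<lambda>j. LINT s:{0..\<epsilon> j}|lborel. \<bar>x s / s\<bar>) \<longlonglongrightarrow> 0" by simp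
  show "\<forall>\<^sub>F j in sequentially. 0 \<le> unif_dist (div_integral 0 x) (div_integral (\<epsilon> j) x)"
    using \<epsilon>(1) by (intro always_eventually allI unif.nonneg
      continuous_imp_D01[OF div_integral_0_continuous[OF x]]
      div_integral_in_D01[OF x]) auto
qed (intro always_eventually allI unif_dist_div_integral_0_le x integrable \<epsilon>)

section \<open>The integral of the Wiener process\<close>

lemma continuous_paths_joint_measurable:
  fixes X :: "'a \<Rightarrow> real \<Rightarrow> real"
  assumes X_cont: "\<And>\<omega>. \<omega> \<in> space M \<Longrightarrow> continuous_on {0..} (X \<omega>)"
    and X_measurable: "\<And>t. 0 \<le> t \<Longrightarrow> (\<lambda>\<omega>. X \<omega> t) \<in> borel_measurable M"
  shows "(\<lambda>(s, \<omega>). X \<omega> (max 0 s)) \<in> borel_measurable (lborel \<Otimes>\<^sub>M M)"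
proof (rule borel_measurable_LIMSEQ_real)
  let ?grid = "\<lambda>m s :: real. real (nat \<lfloor>real (Suc m) * s\<rfloor>) / real (Suc m)"
  show "(\<lambda>(s, \<omega>). X \<omega> (?grid m s)) \<in> borel_measurable (lborel \<Otimes>\<^sub>M M)" for m
  proof -
    have [measurable]: "(\<lambda>\<omega>. X \<omega> (real k / real (Suc m))) \<in> borel_measurable M" for k
      by (simp add: X_measurable)
    have "(\<lambda>p. X (snd p) (?grid m (fst p))) \<in> borel_measurable (lborel \<Otimes>\<^sub>M M)"
      by (rule measurable_compose_countable[where f = "\<lambda>k p. X (snd p) (real k / real (Suc m))"])
         measurable
    then show ?thesis by (simp add: split_beta')
  qed
  have grid_tendsto: "(\<lambda>m. ?grid m s) \<longlonglongrightarrow> max 0 s" for s :: real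
  proof (rule Lim_transform2[OF tendsto_const])
    have "?grid m s = ?grid m (max 0 s)" for m
    proof (cases "0 \<le> s")
      case False
      then have "real (Suc m) * s \<le> 0" by (intro mult_nonneg_nonpos) auto
      then have "nat \<lfloor>real (Suc m) * s\<rfloor> = 0" by linarith
      with False show ?thesis by simp
    qed simp
    then show "(\<lambda>m. max 0 s - ?grid m s) \<longlonglongrightarrow> 0"
      by (intro Lim_null_comparison[OF always_eventually LIMSEQ_Suc[OF lim_1_over_n]] allI)
         (simp only: real_norm_def grid_point_close zero_less_Suc max.cobounded1)
  qed
  fix p assume "p \<in> space ((lborel :: real measure) \<Otimes>\<^sub>M M)"
  then obtain s \<omega> where p: "p = (s, \<omega>)" "\<omega> \<in> space M" by (cases p) (auto simp: space_pair_measure)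
  have "(\<lambda>m. X \<omega> (?grid m s)) \<longlonglongrightarrow> X \<omega> (max 0 s)"
    by (rule continuous_on_tendsto_compose[OF X_cont[OF p(2)] grid_tendsto]) auto
  then show "(\<lambda>m. case p of (s, \<omega>) \<Rightarrow> X \<omega> (?grid m s)) \<longlonglongrightarrow> (case p of (s, \<omega>) \<Rightarrow> X \<omega> (max 0 s))"
    by (simp add: p)
qed

lemma integrable_powr_minus_half: "integrable lborel (\<lambda>s::real. indicator {0..1} s * s powr (- 1 / 2))"
proof -
  have "((\<lambda>s::real. s powr (- 1 / 2)) has_integral 1 powr (- 1 / 2 + 1) / (- 1 / 2 + 1)) {0..1}"
    by (rule has_integral_powr_from_0) auto
  then have "(\<lambda>s::real. s powr (- 1 / 2)) absolutely_integrable_on {0..1}"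
    by (intro nonnegative_absolutely_integrable_1) auto
  then show ?thesis
    by (simp add: set_integrable_def integrable_completion)
qed

context
  fixes N :: "'b measure" and W :: "real \<Rightarrow> 'b \<Rightarrow> real"
  assumes W: "standard_wiener_process N W"
begin

interpretation N: prob_space N
  using W by (simp add: standard_wiener_process_def)

lemma wiener_continuous: "\<omega> \<in> space N \<Longrightarrow> continuous_on {0..} (\<lambda>t. W t \<omega>)"
  using W by (simp add: standard_wiener_process_def)

lemma wiener_measurable: "0 \<le> t \<Longrightarrow> W t \<in> borel_measurable N"
  using W by (simp add: standard_wiener_process_def)

lemma wiener_in_D01: "\<omega> \<in> space N \<Longrightarrow> (\<lambda>t. W t \<omega>) \<in> D01"
  by (rule continuous_imp_D01[OF continuous_on_subset[OF wiener_continuous]]) auto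

lemma random_element_wiener: "random_element D01 unif_dist N (\<lambda>\<omega> t. W t \<omega>)"
  by (rule random_element_continuous_path[OF continuous_on_subset[OF wiener_continuous]
      wiener_measurable]) auto

lemma wiener_joint_measurable: "(\<lambda>(s, \<omega>). W (max 0 s) \<omega>) \<in> borel_measurable (lborel \<Otimes>\<^sub>M N)"
  by (rule continuous_paths_joint_measurable[of N "\<lambda>\<omega> t. W t \<omega>", OF wiener_continuous
      wiener_measurable])

lemma wiener_abs_moment:
  assumes "0 < t"
  shows "has_bochner_integral N (\<lambda>\<omega>. \<bar>W t \<omega>\<bar>) (sqrt t * sqrt (2 / pi))"
proof -
  have "distributed N lborel (\<lambda>\<omega>. W t \<omega> - W 0 \<omega>) (normal_density 0 (sqrt (t - 0)))"
    using W assms unfolding standard_wiener_process_def by blast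
  then have increment: "distributed N lborel (\<lambda>\<omega>. W t \<omega> - W 0 \<omega>) (normal_density 0 (sqrt t))" by simp
  have "has_bochner_integral lborel (\<lambda>x. normal_density 0 (sqrt t) x * \<bar>x\<bar>) (sqrt t * sqrt (2 / pi))"
    using normal_moment_abs_odd[of "sqrt t" 0 0] assms by simp
  then have "has_bochner_integral N (\<lambda>\<omega>. \<bar>W t \<omega> - W 0 \<omega>\<bar>) (sqrt t * sqrt (2 / pi))"
    using distributed_integrable[OF increment, of abs] distributed_integral[OF increment, of abs]
    by (simp add: has_bochner_integral_iff)
  moreover have "\<bar>W t \<omega> - W 0 \<omega>\<bar> = \<bar>W t \<omega>\<bar>" if "\<omega> \<in> space N" for \<omega>
    using W that by (simp add: standard_wiener_process_def)
  ultimately show ?thesis by (simp cong: has_bochner_integral_cong)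
qed

text \<open>By Tonelli, since \<open>E \<bar>W s\<bar> / s\<close> is a multiple of \<open>s powr (- 1 / 2)\<close>.\<close>
lemma wiener_AE_div_integrable: "AE \<omega> in N. set_integrable lborel {0..1} (\<lambda>s. W s \<omega> / s)"
proof -
  interpret pair_sigma_finite lborel N ..
  define f where "f s \<omega> = indicator {0..1} s * (W (max 0 s) \<omega> / s)" for s \<omega>
  have moment: "has_bochner_integral N (\<lambda>\<omega>. \<bar>f s \<omega>\<bar>)
      (indicator {0..1} s * s powr (- 1 / 2) * sqrt (2 / pi))" for s
  proof (cases "s \<in> {0<..1}")
    case True
    have "sqrt s / s = s powr (- 1 / 2)"
      using True powr_diff[of s "1 / 2" 1] by (simp add: powr_half_sqrt)
    then have "sqrt s * sqrt (2 / pi) / s = s powr (- 1 / 2) * sqrt (2 / pi)"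
      by (metis times_divide_eq_left)
    with True has_bochner_integral_divide_zero[OF wiener_abs_moment[of s], of s] show ?thesis
      by (simp add: f_def)
  next
    case False
    then have "s = 0 \<or> s \<notin> {0..1}" by auto
    then show ?thesis by (auto simp: f_def)
  qed
  have "integrable (lborel \<Otimes>\<^sub>M N) (case_prod f)"
  proof (rule Fubini_integrable)
    have [measurable]: "(\<lambda>(s, \<omega>). W (max 0 s) \<omega>) \<in> borel_measurable (lborel \<Otimes>\<^sub>M N)"
      by (rule wiener_joint_measurable)
    show "case_prod f \<in> borel_measurable (lborel \<Otimes>\<^sub>M N)"
      unfolding f_def by measurable
    show "integrable lborel (\<lambda>s. \<integral>\<omega>. norm (case_prod f (s, \<omega>)) \<partial>N)"
      using integrable_powr_minus_half by (simp add: has_bochner_integral_integral_eq[OF moment])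
    have "f s \<in> borel_measurable N" for s
      unfolding f_def using wiener_measurable[of "max 0 s"] by measurable
    then have "integrable N (f s)" for s
      by (intro integrable_abs_cancel[OF integrable.intros[OF moment]])
    then show "AE s in lborel. integrable N (\<lambda>\<omega>. case_prod f (s, \<omega>))" by simp
  qed
  then have "AE \<omega> in N. integrable lborel (\<lambda>s. f s \<omega>)" by (rule AE_integrable_snd)
  moreover have "(\<lambda>s. f s \<omega>) = (\<lambda>s. indicator {0..1} s *\<^sub>R (W s \<omega> / s))" for \<omega>
    by (auto simp: f_def indicator_def)
  ultimately show ?thesis by (simp add: set_integrable_def)
qed

lemma random_element_wiener_div_integral:
  "random_element D01 unif_dist N (\<lambda>\<omega>. div_integral 0 (\<lambda>t. W t \<omega>))"
proof (rule random_element_continuous_path)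
  fix t :: real
  have [measurable]: "(\<lambda>(\<omega>, s). W (max 0 s) \<omega>) \<in> borel_measurable (N \<Otimes>\<^sub>M lborel)"
    using measurable_pair_swap[OF wiener_joint_measurable] by (simp add: split_beta')
  have "(\<lambda>\<omega>. LINT s|lborel. indicator {0..t} s *\<^sub>R (W (max 0 s) \<omega> / s)) \<in> borel_measurable N"
    by measurable
  also have "(\<lambda>\<omega>. LINT s|lborel. indicator {0..t} s *\<^sub>R (W (max 0 s) \<omega> / s)) =
      (\<lambda>\<omega>. div_integral 0 (\<lambda>t. W t \<omega>) t)"
    unfolding div_integral_def set_lebesgue_integral_def
    by (intro ext Bochner_Integration.integral_cong) (auto simp: indicator_def)
  finally show "(\<lambda>\<omega>. div_integral 0 (\<lambda>t. W t \<omega>) t) \<in> borel_measurable N" .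
qed (rule div_integral_0_continuous[OF wiener_in_D01])

lemma wiener_div_integral_converges_weakly:
  assumes "\<And>j. \<epsilon> j \<in> {0<..1}" "\<epsilon> \<longlonglongrightarrow> 0"
  shows "converges_weakly D01 unif_dist N (\<lambda>j \<omega>. div_integral (\<epsilon> j) (\<lambda>t. W t \<omega>))
    N (\<lambda>\<omega>. div_integral 0 (\<lambda>t. W t \<omega>))"
proof (rule converges_weakly_if_AE[OF N.prob_space_axioms _ random_element_wiener_div_integral])
  show "random_element D01 unif_dist N (\<lambda>\<omega>. div_integral (\<epsilon> j) (\<lambda>t. W t \<omega>))" for j
    using assms(1) by (intro random_element_compose[OF
      random_element_skorokhod_if_unif[OF random_element_wiener]]
      div_integral_seq_continuous) auto
  show "AE \<omega> in N. (\<lambda>j. unif_dist (div_integral 0 (\<lambda>t. W t \<omega>)) (div_integral (\<epsilon> j) (\<lambda>t. W t \<omega>))) \<longlonglongrightarrow> 0"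
    using wiener_AE_div_integrable AE_space
    by eventually_elim (rule div_integral_tendsto[OF wiener_in_D01 _ assms])
qed

end

section \<open>Comparison of sums and integrals\<close>

lemma step_path_has_integral_cell:
  assumes n: "0 < n" and ab: "real k / real n \<le> a" "a \<le> b" "b \<le> real (Suc k) / real n"
  shows "(step_path n z has_integral (b - a) * z k) {a..b}"
proof (rule has_integral_spike_finite[where S = "{b}"])
  show "((\<lambda>_. z k) has_integral (b - a) * z k) {a..b}"
    using has_integral_const_real[of "z k" a b] ab(2) by simp
  fix s assume "s \<in> {a..b} - {b}"
  then have "real k / real n \<le> s" "s < real (Suc k) / real n" using ab by auto
  then have "real k \<le> real n * s" "real n * s < real (Suc k)"
    using n by (simp_all add: pos_divide_le_eq pos_less_divide_eq mult.commute)
  then have "nat \<lfloor>real n * s\<rfloor> = k" by linarith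
  then show "step_path n z s = z k" by (simp add: step_path_def)
qed simp

lemma step_path_has_integral_grid:
  assumes n: "0 < n"
  shows "(step_path n z has_integral (\<Sum>k<m. z k) / real n) {0..real m / real n}"
proof (induction m)
  case (Suc m)
  have "(step_path n z has_integral (real (Suc m) / real n - real m / real n) * z m)
      {real m / real n..real (Suc m) / real n}"
    by (rule step_path_has_integral_cell[OF n]) (simp_all add: divide_right_mono)
  moreover have "(real (Suc m) / real n - real m / real n) * z m = z m / real n"
    by (simp add: diff_divide_distrib[symmetric])
  ultimately have "(step_path n z has_integral (\<Sum>k<m. z k) / real n + z m / real n)
      {0..real (Suc m) / real n}"
    by (intro has_integral_combine[OF _ _ Suc]) (auto simp: divide_right_mono)
  then show ?case by (simp add: add_divide_distrib)
qed auto

lemma step_path_set_integral: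
  assumes n: "0 < n" and t: "t \<in> {0..1}"
  shows "(LINT s:{0..t}|lborel. step_path n z s) =
    ((\<Sum>k<nat \<lfloor>real n * t\<rfloor>. z k) + (real n * t - real (nat \<lfloor>real n * t\<rfloor>))
      * z (nat \<lfloor>real n * t\<rfloor>)) / real n"
proof -
  define m where "m = nat \<lfloor>real n * t\<rfloor>"
  have "0 \<le> real n * t" using t by simp
  then have "real m \<le> real n * t" "real n * t \<le> real (Suc m)" unfolding m_def by linarith+
  then have m: "real m / real n \<le> t" "t \<le> real (Suc m) / real n"
    using n by (simp_all add: pos_divide_le_eq pos_le_divide_eq mult.commute)
  have "(step_path n z has_integral (\<Sum>k<m. z k) / real n + (t - real m / real n) * z m) {0..t}"
    using step_path_has_integral_cell[OF n order_refl m, of z]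
    by (intro has_integral_combine[OF _ m(1) step_path_has_integral_grid[OF n]]) auto
  moreover have "(LINT s:{0..t}|lborel. step_path n z s) = integral {0..t} (step_path n z)"
    using t by (intro set_borel_integral_eq_integral(2) D01_set_integrable step_path_in_D01) auto
  moreover have "(\<Sum>k<m. z k) / real n + (t - real m / real n) * z m =
      ((\<Sum>k<m. z k) + (real n * t - real m) * z m) / real n"
    using n by (simp add: field_simps)
  ultimately show ?thesis unfolding m_def[symmetric] by (simp add: integral_unique)
qed

lemma step_path_div_error:
  fixes c :: "nat \<Rightarrow> real"
  assumes n: "0 < n" and c0: "c 0 = 0" and s: "0 \<le> s"
  shows "\<bar>indicator {\<epsilon>..} s * (step_path n (\<lambda>k. real k * c k) s / s)
      - step_path n (\<lambda>k. real n * c k) s\<bar>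
    \<le> step_path n (\<lambda>k. real n * (\<bar>c k\<bar> / real k + (if real k < \<epsilon> * real n then \<bar>c k\<bar> else 0))) s"
proof -
  define k where "k = nat \<lfloor>real n * s\<rfloor>"
  have "0 \<le> real n * s" using s by simp
  then have k: "real k \<le> real n * s" "real n * s \<le> real k + 1" unfolding k_def by linarith+
  consider "k = 0" | "0 < k" "s < \<epsilon>" | "0 < k" "\<epsilon> \<le> s" by linarith
  then have "\<bar>indicator {\<epsilon>..} s * (real k * c k / s) - real n * c k\<bar>
      \<le> real n * (\<bar>c k\<bar> / real k + (if real k < \<epsilon> * real n then \<bar>c k\<bar> else 0))"
  proof cases
    case 1
    with c0 show ?thesis by simp
  next
    case 2
    then have "real n * s < real n * \<epsilon>" using n by simp
    with k(1) have "real k < \<epsilon> * real n" by (simp add: mult.commute)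
    with 2 show ?thesis by (simp add: abs_mult distrib_left)
  next
    case 3
    with k(1) have "s \<noteq> 0" by auto
    with s have s_pos: "0 < s" by simp
    have "\<bar>real k * c k / s - real n * c k\<bar> = \<bar>c k\<bar> * (\<bar>real k - real n * s\<bar> / s)"
      using s_pos by (simp add: abs_mult[symmetric] abs_divide[symmetric] field_simps)
    also have "\<dots> \<le> \<bar>c k\<bar> * (1 / (real k / real n))"
      using k 3 n s_pos by (intro mult_left_mono frac_le) (auto simp: pos_divide_le_eq mult.commute)
    finally show ?thesis using 3 n by (auto simp: distrib_left mult.commute intro: order_trans)
  qed
  then show ?thesis unfolding step_path_def k_def[symmetric] .
qed

lemma div_integral_step_path_near_integral:
  fixes c :: "nat \<Rightarrow> real"
  assumes n: "0 < n" and \<epsilon>: "0 < \<epsilon>" and c0: "c 0 = 0" and t: "t \<in> {0..1}"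
  shows "\<bar>div_integral \<epsilon> (step_path n (\<lambda>k. real k * c k)) t
      - (LINT s:{0..t}|lborel. step_path n (\<lambda>k. real n * c k) s)\<bar>
    \<le> (\<Sum>k<n. \<bar>c k\<bar> / real k + (if real k < \<epsilon> * real n then \<bar>c k\<bar> else 0))"
proof -
  define x where "x = step_path n (\<lambda>k. real k * c k)"
  define v where "v = step_path n (\<lambda>k. real n * c k)"
  define r where "r k = \<bar>c k\<bar> / real k + (if real k < \<epsilon> * real n then \<bar>c k\<bar> else 0)" for k
  have integrable: "integrable lborel (\<lambda>s. indicator {\<epsilon>..t} s *\<^sub>R (x s / s))"
    "integrable lborel (\<lambda>s. indicator {0..t} s *\<^sub>R v s)"
    "integrable lborel (\<lambda>s. indicator {0..1} s *\<^sub>R step_path n (\<lambda>k. real n * r k) s)"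
    unfolding set_integrable_def[symmetric] x_def v_def
    using t D01_div_set_integrable[OF step_path_in_D01 \<epsilon>] D01_set_integrable[OF step_path_in_D01]
    by auto
  have "norm (indicator {\<epsilon>..t} s *\<^sub>R (x s / s) - indicator {0..t} s *\<^sub>R v s)
      \<le> indicator {0..1} s *\<^sub>R step_path n (\<lambda>k. real n * r k) s" for s
  proof (cases "s \<in> {0..t}")
    case True
    then have "indicator {\<epsilon>..t} s = (indicator {\<epsilon>..} s :: real)" by (simp add: indicator_def)
    with True t step_path_div_error[where c = c, OF n c0, of s \<epsilon>] show ?thesis
      by (simp add: x_def v_def r_def)
  next
    case False
    have "0 \<le> step_path n (\<lambda>k. real n * r k) s" by (simp add: step_path_def r_def)
    with False \<epsilon> show ?thesis by (auto simp: indicator_def)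
  qed
  then have "norm (LINT s|lborel. indicator {\<epsilon>..t} s *\<^sub>R (x s / s) - indicator {0..t} s *\<^sub>R v s)
      \<le> (LINT s:{0..1}|lborel. step_path n (\<lambda>k. real n * r k) s)"
    unfolding set_lebesgue_integral_def
    by (intro Bochner_Integration.integral_norm_bound_integral
        Bochner_Integration.integrable_diff integrable)
  also have "\<dots> = (\<Sum>k<n. r k)"
    using n by (simp add: step_path_set_integral sum_distrib_left[symmetric])
  finally show ?thesis
    using integrable by (simp add: div_integral_def set_lebesgue_integral_def x_def v_def r_def)
qed

lemma sum_if_less_le:
  fixes f :: "nat \<Rightarrow> real"
  assumes "\<And>k. 0 \<le> f k"
  shows "(\<Sum>k<n. if real k < a then f k else 0) \<le> (\<Sum>k\<le>nat \<lfloor>a\<rfloor>. f k)"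
proof -
  have "(\<Sum>k<n. if real k < a then f k else 0) = (\<Sum>k\<in>{k\<in>{..<n}. real k < a}. f k)"
    by (rule sum.inter_filter[symmetric]) simp
  also have "\<dots> \<le> (\<Sum>k\<le>nat \<lfloor>a\<rfloor>. f k)"
    using assms by (intro sum_mono2) (auto simp: le_nat_floor)
  finally show ?thesis .
qed

lemma div_integral_step_path_error:
  fixes c :: "nat \<Rightarrow> real"
  assumes n: "0 < n" and \<epsilon>: "0 < \<epsilon>" and c0: "c 0 = 0" and t: "t \<in> {0..1}"
  defines "m \<equiv> nat \<lfloor>real n * t\<rfloor>"
  shows "\<bar>div_integral \<epsilon> (step_path n (\<lambda>k. real k * c k)) t - (\<Sum>k\<le>m. c k)\<bar>
    \<le> \<bar>c m\<bar> + (\<Sum>k<n. \<bar>c k\<bar> / real k) + (\<Sum>k\<le>nat \<lfloor>\<epsilon> * real n\<rfloor>. \<bar>c k\<bar>)"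
proof -
  have "\<bar>div_integral \<epsilon> (step_path n (\<lambda>k. real k * c k)) t
        - (LINT s:{0..t}|lborel. step_path n (\<lambda>k. real n * c k) s)\<bar>
      \<le> (\<Sum>k<n. \<bar>c k\<bar> / real k) + (\<Sum>k\<le>nat \<lfloor>\<epsilon> * real n\<rfloor>. \<bar>c k\<bar>)"
    using div_integral_step_path_near_integral[where c = c, OF n \<epsilon> c0 t]
      sum_if_less_le[of "\<lambda>k. \<bar>c k\<bar>" "\<epsilon> * real n" n]
    unfolding sum.distrib by simp
  moreover have "(LINT s:{0..t}|lborel. step_path n (\<lambda>k. real n * c k) s) =
      (\<Sum>k<m. c k) + (real n * t - real m) * c m"
    using n by (simp add: step_path_set_integral[OF n t] m_def sum_distrib_left[symmetric] field_simps)
  moreover have "\<bar>(\<Sum>k<m. c k) + (real n * t - real m) * c m - (\<Sum>k\<le>m. c k)\<bar> \<le> \<bar>c m\<bar>"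
  proof -
    have "0 \<le> real n * t" using t by simp
    then have "\<bar>real n * t - real m - 1\<bar> \<le> 1" unfolding m_def by linarith
    moreover have "(\<Sum>k<m. c k) + (real n * t - real m) * c m - (\<Sum>k\<le>m. c k) =
      (real n * t - real m - 1) * c m"
      by (simp add: lessThan_Suc_atMost[symmetric] algebra_simps)
    ultimately show ?thesis by (simp add: abs_mult mult_left_le_one_le)
  qed
  ultimately show ?thesis by linarith
qed

definition log_error :: "(nat \<Rightarrow> real) \<Rightarrow> nat \<Rightarrow> real" where
  "log_error c n = (\<Sum>k\<le>n. \<bar>ln (1 + c k) - c k\<bar> + \<bar>c k\<bar> / real k)"

lemma unif_dist_div_integral_log_sum_le:
  fixes c :: "nat \<Rightarrow> real"
  assumes n: "0 < n" and \<epsilon>: "0 < \<epsilon>" and \<kappa>: "0 \<le> \<kappa>" and c0: "c 0 = 0" and L: "\<And>k. \<bar>c k\<bar> \<le> L"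
  shows "unif_dist (div_integral \<epsilon> (step_path n (\<lambda>k. \<kappa> * (real k * c k))))
    (step_path n (\<lambda>m. \<kappa> * (\<Sum>k\<le>m. ln (1 + c k))))
    \<le> \<kappa> * (L + log_error c n + (\<Sum>k\<le>nat \<lfloor>\<epsilon> * real n\<rfloor>. \<bar>c k\<bar>))"
proof (rule unif_dist_least)
  fix t :: real assume t: "t \<in> {0..1}"
  define m where "m = nat \<lfloor>real n * t\<rfloor>"
  have "real n * t \<le> real n" using t by (simp add: mult_left_le)
  then have "m \<le> n" unfolding m_def by linarith
  define I where "I = div_integral \<epsilon> (step_path n (\<lambda>k. real k * c k)) t"
  have "\<bar>(\<Sum>k\<le>m. c k) - (\<Sum>k\<le>m. ln (1 + c k))\<bar> \<le> (\<Sum>k\<le>m. \<bar>ln (1 + c k) - c k\<bar>)"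
    unfolding sum_subtractf[symmetric] abs_minus_commute[of "ln _"] by (rule sum_abs)
  also have "\<dots> \<le> (\<Sum>k\<le>n. \<bar>ln (1 + c k) - c k\<bar>)" using \<open>m \<le> n\<close> by (intro sum_mono2) auto
  finally have "\<bar>(\<Sum>k\<le>m. c k) - (\<Sum>k\<le>m. ln (1 + c k))\<bar> \<le> (\<Sum>k\<le>n. \<bar>ln (1 + c k) - c k\<bar>)" .
  moreover have "\<bar>I - (\<Sum>k\<le>m. c k)\<bar> \<le> L + (\<Sum>k\<le>n. \<bar>c k\<bar> / real k) + (\<Sum>k\<le>nat \<lfloor>\<epsilon> * real n\<rfloor>. \<bar>c k\<bar>)"
    using div_integral_step_path_error[where c = c, OF n \<epsilon> c0 t] L[of m]
      sum_mono2[of "{..n}" "{..<n}" "\<lambda>k. \<bar>c k\<bar> / real k"]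
    unfolding I_def m_def by fastforce
  ultimately have "\<bar>I - (\<Sum>k\<le>m. ln (1 + c k))\<bar> \<le> L + log_error c n + (\<Sum>k\<le>nat \<lfloor>\<epsilon> * real n\<rfloor>. \<bar>c k\<bar>)"
    unfolding log_error_def sum.distrib by linarith
  from mult_left_mono[OF this \<kappa>]
  have "\<bar>\<kappa> * I - \<kappa> * (\<Sum>k\<le>m. ln (1 + c k))\<bar> \<le> \<kappa> * (L + log_error c n + (\<Sum>k\<le>nat \<lfloor>\<epsilon> * real n\<rfloor>. \<bar>c k\<bar>))"
    using \<kappa> by (simp add: abs_mult right_diff_distrib[symmetric])
  moreover have "div_integral \<epsilon> (step_path n (\<lambda>k. \<kappa> * (real k * c k))) t = \<kappa> * I"
    by (simp add: I_def div_integral_def step_path_def times_divide_eq_right[symmetric]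
        del: times_divide_eq_right)
  ultimately show "\<bar>div_integral \<epsilon> (step_path n (\<lambda>k. \<kappa> * (real k * c k))) t
        - step_path n (\<lambda>m. \<kappa> * (\<Sum>k\<le>m. ln (1 + c k))) t\<bar>
      \<le> \<kappa> * (L + log_error c n + (\<Sum>k\<le>nat \<lfloor>\<epsilon> * real n\<rfloor>. \<bar>c k\<bar>))"
    by (simp add: step_path_def m_def)
qed

definition log_error_dominated :: "real \<Rightarrow> real \<Rightarrow> (nat \<Rightarrow> real) \<Rightarrow> bool" where
  "log_error_dominated \<delta> L c \<longleftrightarrow> (\<forall>k. \<bar>c k\<bar> \<le> L) \<and> (\<forall>n. log_error c n \<le> L + \<delta> * (\<Sum>k\<le>n. \<bar>c k\<bar>))"

lemma log_error_term_le:
  fixes x :: real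
  assumes "\<bar>x\<bar> < min (1 / 2) (\<delta> / 4)" and "1 / real k < \<delta> / 2"
  shows "\<bar>ln (1 + x) - x\<bar> + \<bar>x\<bar> / real k \<le> \<delta> * \<bar>x\<bar>"
proof -
  have "\<bar>ln (1 + x) - x\<bar> \<le> 2 * x\<^sup>2"
    using assms(1) by (intro abs_ln_one_plus_x_minus_x_bound) auto
  also have "\<dots> = (2 * \<bar>x\<bar>) * \<bar>x\<bar>" by (simp add: power2_eq_square)
  also have "\<dots> \<le> \<delta> / 2 * \<bar>x\<bar>" using assms(1) by (intro mult_right_mono) auto
  finally have "\<bar>ln (1 + x) - x\<bar> \<le> \<delta> / 2 * \<bar>x\<bar>" .
  moreover have "\<bar>x\<bar> / real k \<le> \<delta> / 2 * \<bar>x\<bar>"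
    using mult_right_mono[OF less_imp_le[OF assms(2)] abs_ge_zero[of x]] by simp
  ultimately have "\<bar>ln (1 + x) - x\<bar> + \<bar>x\<bar> / real k \<le> \<delta> / 2 * \<bar>x\<bar> + \<delta> / 2 * \<bar>x\<bar>"
    by (rule add_mono)
  then show ?thesis by simp
qed

lemma log_error_dominated_if_tendsto_0:
  fixes c :: "nat \<Rightarrow> real"
  assumes c: "c \<longlonglongrightarrow> 0" and \<delta>: "0 < \<delta>"
  shows "\<exists>L::nat. log_error_dominated \<delta> (real L) c"
proof -
  define e where "e k = \<bar>ln (1 + c k) - c k\<bar> + \<bar>c k\<bar> / real k" for k
  have e_nonneg: "0 \<le> e k" for k by (simp add: e_def)
  have "\<forall>\<^sub>F k in sequentially. \<bar>c k\<bar> < min (1 / 2) (\<delta> / 4)"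
    using \<delta> tendsto_rabs_zero[OF c] by (intro order_tendstoD(2)) auto
  moreover have "\<forall>\<^sub>F k in sequentially. 1 / real k < \<delta> / 2"
    using \<delta> by (intro order_tendstoD(2)[OF lim_1_over_n]) auto
  ultimately have "\<forall>\<^sub>F k in sequentially. e k \<le> \<delta> * \<bar>c k\<bar>"
    unfolding e_def by eventually_elim (rule log_error_term_le)
  then obtain K where K: "\<And>k. k \<ge> K \<Longrightarrow> e k \<le> \<delta> * \<bar>c k\<bar>" by (auto simp: eventually_sequentially)
  have "Bseq c" using c by (auto intro: convergent_imp_Bseq convergentI)
  then obtain b where b: "\<forall>k. norm (c k) \<le> b" by (rule BseqE)
  obtain L :: nat where L: "max b (\<Sum>k<K. e k) \<le> real L" using real_arch_simple by blast
  have "log_error c n \<le> real L + \<delta> * (\<Sum>k\<le>n. \<bar>c k\<bar>)" for n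
  proof -
    have "log_error c n \<le> (\<Sum>k\<le>n. (if k < K then e k else 0) + \<delta> * \<bar>c k\<bar>)"
      unfolding log_error_def e_def[symmetric] using K \<delta> by (intro sum_mono) (auto simp: not_less)
    also have "\<dots> = (\<Sum>k\<le>n. if k < K then e k else 0) + \<delta> * (\<Sum>k\<le>n. \<bar>c k\<bar>)"
      by (simp add: sum.distrib sum_distrib_left)
    also have "(\<Sum>k\<le>n. if k < K then e k else 0) = (\<Sum>k\<in>{k\<in>{..n}. k < K}. e k)"
      by (rule sum.inter_filter[symmetric]) simp
    also have "(\<Sum>k\<in>{k\<in>{..n}. k < K}. e k) \<le> (\<Sum>k<K. e k)"
      using e_nonneg by (intro sum_mono2) auto
    finally show ?thesis using L by simp
  qed
  moreover have "\<bar>c k\<bar> \<le> real L" for k using b[rule_format, of k] L by simp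
  ultimately show ?thesis unfolding log_error_dominated_def by blast
qed

section \<open>Convergence along subsequences\<close>

lemma subsequence_index:
  fixes a :: "nat \<Rightarrow> nat"
  assumes a: "filterlim a at_top sequentially"
  obtains j where "filterlim j at_top sequentially"
    "\<forall>\<^sub>F k in sequentially. a (j k) \<le> k \<and> k < a (Suc (j k))"
proof -
  define j where "j k = (LEAST i. k < a (Suc i))" for k
  have above: "k < a (Suc (j k))" for k
  proof -
    have "\<forall>\<^sub>F i in sequentially. Suc k \<le> a i"
      using a by (simp add: filterlim_at_top)
    then obtain i where "\<forall>l\<ge>i. Suc k \<le> a l" by (auto simp: eventually_sequentially)
    then have "k < a (Suc i)" by (simp add: Suc_le_lessD)
    then have "\<exists>i. k < a (Suc i)" ..
    then show ?thesis unfolding j_def by (rule LeastI_ex)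
  qed
  have below: "a (j k) \<le> k" if "0 < j k" for k
    using not_less_Least[of "j k - 1" "\<lambda>i. k < a (Suc i)"] that by (simp add: j_def)
  have j: "filterlim j at_top sequentially"
    unfolding filterlim_at_top
  proof
    fix Z :: nat
    have "\<forall>\<^sub>F k in sequentially. \<forall>i\<in>{..<Z}. a (Suc i) \<le> k"
      by (intro eventually_ball_finite ballI eventually_ge_at_top) simp
    then show "\<forall>\<^sub>F k in sequentially. Z \<le> j k"
      by eventually_elim (metis above lessThan_iff not_le)
  qed
  then have "\<forall>\<^sub>F k in sequentially. 1 \<le> j k" by (simp only: filterlim_at_top)
  then have "\<forall>\<^sub>F k in sequentially. a (j k) \<le> k \<and> k < a (Suc (j k))"
    by eventually_elim (simp add: above below)
  with j show thesis by (rule that)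
qed

lemma monotone_ratio_tendsto:
  fixes s :: "nat \<Rightarrow> real" and a :: "nat \<Rightarrow> nat"
  assumes nonneg: "\<And>k. 1 \<le> k \<Longrightarrow> 0 \<le> s k" and mono: "\<And>k. 1 \<le> k \<Longrightarrow> s k \<le> s (Suc k)"
    and a: "filterlim a at_top sequentially" "(\<lambda>i. real (a (Suc i)) / real (a i)) \<longlonglongrightarrow> 1"
    and lim: "(\<lambda>i. s (a i) / real (a i)) \<longlonglongrightarrow> \<mu>"
  shows "(\<lambda>k. s k / real k) \<longlonglongrightarrow> \<mu>"
proof -
  have s_mono: "s k \<le> s l" if "1 \<le> k" "k \<le> l" for k l
    using that(2,1) by (induction rule: dec_induct) (use mono in \<open>auto intro: order_trans\<close>)
  obtain j where j: "filterlim j at_top sequentially"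
    and between: "\<forall>\<^sub>F k in sequentially. a (j k) \<le> k \<and> k < a (Suc (j k))"
    by (rule subsequence_index[OF a(1)])
  have pos: "\<forall>\<^sub>F k in sequentially. 1 \<le> a (j k)"
    using filterlim_compose[OF a(1) j] by (simp add: filterlim_at_top)
  have lower: "(\<lambda>i. s (a i) / real (a i) / (real (a (Suc i)) / real (a i))) \<longlonglongrightarrow> \<mu>"
    using tendsto_divide[OF lim a(2)] by simp
  have upper: "(\<lambda>i. s (a (Suc i)) / real (a (Suc i)) * (real (a (Suc i)) / real (a i))) \<longlonglongrightarrow> \<mu>"
    using tendsto_mult[OF LIMSEQ_Suc[OF lim] a(2)] by simp
  show ?thesis
  proof (rule tendsto_sandwich[OF _ _ filterlim_compose[OF lower j] filterlim_compose[OF upper j]])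
    show "\<forall>\<^sub>F k in sequentially.
        s (a (j k)) / real (a (j k)) / (real (a (Suc (j k))) / real (a (j k))) \<le> s k / real k"
      using between pos
    proof eventually_elim
      case (elim k)
      have "s (a (j k)) / real (a (Suc (j k))) \<le> s k / real k"
        using elim nonneg[of k] by (intro frac_le s_mono) auto
      with elim show ?case by simp
    qed
    show "\<forall>\<^sub>F k in sequentially.
        s k / real k \<le> s (a (Suc (j k))) / real (a (Suc (j k)))
          * (real (a (Suc (j k))) / real (a (j k)))"
      using between pos
    proof eventually_elim
      case (elim k)
      have "s k / real k \<le> s (a (Suc (j k))) / real (a (j k))"
        using elim nonneg[of "a (Suc (j k))"] by (intro frac_le s_mono) auto
      with elim show ?case by simp
    qed
  qed
qed

lemma AE_tendsto_0_if_summable_expectation: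
  fixes f :: "nat \<Rightarrow> 'a \<Rightarrow> real"
  assumes f: "\<And>i. integrable M (f i)" and summable: "summable (\<lambda>i. \<integral>x. \<bar>f i x\<bar> \<partial>M)"
  shows "AE x in M. (\<lambda>i. f i x) \<longlonglongrightarrow> 0"
proof -
  have [measurable]: "f i \<in> borel_measurable M" for i using f by (rule borel_measurable_integrable)
  have "(\<integral>\<^sup>+x. (\<Sum>i. ennreal \<bar>f i x\<bar>) \<partial>M) = (\<Sum>i. \<integral>\<^sup>+x. ennreal \<bar>f i x\<bar> \<partial>M)"
    by (rule nn_integral_suminf) measurable
  also have "\<dots> = (\<Sum>i. ennreal (\<integral>x. \<bar>f i x\<bar> \<partial>M))"
    using f by (intro suminf_cong nn_integral_eq_integral) auto
  also have "\<dots> = ennreal (\<Sum>i. \<integral>x. \<bar>f i x\<bar> \<partial>M)"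
    by (intro suminf_ennreal2 summable) auto
  also have "\<dots> < \<infinity>" by simp
  finally have "AE x in M. (\<Sum>i. ennreal \<bar>f i x\<bar>) \<noteq> \<infinity>"
    by (intro nn_integral_noteq_infinite) auto
  then show ?thesis
  proof eventually_elim
    case (elim x)
    then have "summable (\<lambda>i. \<bar>f i x\<bar>)" by (intro summable_suminf_not_top) auto
    from summable_LIMSEQ_zero[OF this] show ?case by (simp add: tendsto_rabs_zero_iff)
  qed
qed

lemma sum_inverse_sqrt_le: "(\<Sum>k\<le>m. 1 / sqrt (real k)) \<le> 2 * sqrt (real m)"
proof (induction m)
  case (Suc m)
  let ?a = "sqrt (real m)" and ?b = "sqrt (real (Suc m))"
  have "1 = (?b - ?a) * (?b + ?a)" by (simp add: algebra_simps)
  also have "\<dots> \<le> (?b - ?a) * (2 * ?b)" by (intro mult_left_mono) simp_all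
  finally have "1 \<le> (?b - ?a) * (2 * ?b)" .
  moreover have "0 < ?b" by simp
  ultimately have "1 / ?b \<le> 2 * (?b - ?a)" by (simp only: pos_divide_le_eq mult_ac)
  with Suc show ?case by simp
qed simp

section \<open>Partial sums\<close>

locale monotone_sums = prob_space M for M :: "'a measure" +
  fixes S :: "nat \<Rightarrow> 'a \<Rightarrow> real" and \<mu> \<sigma> C :: real
  assumes S_measurable: "\<And>k. 1 \<le> k \<Longrightarrow> S k \<in> borel_measurable M"
    and S_pos: "\<And>k \<omega>. 1 \<le> k \<Longrightarrow> \<omega> \<in> space M \<Longrightarrow> 0 < S k \<omega>"
    and S_mono: "\<And>k \<omega>. 1 \<le> k \<Longrightarrow> \<omega> \<in> space M \<Longrightarrow> S k \<omega> \<le> S (Suc k) \<omega>"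
    and \<mu>_pos: "0 < \<mu>" and \<sigma>_pos: "0 < \<sigma>" and C_nonneg: "0 \<le> C"
    and S_moment: "\<And>n. 1 \<le> n \<Longrightarrow> (\<integral>\<^sup>+\<omega>. ennreal \<bar>S n \<omega> - real n * \<mu>\<bar> \<partial>M) \<le> ennreal (C * sqrt (real n))"
begin

definition rel_dev :: "nat \<Rightarrow> 'a \<Rightarrow> real" where
  "rel_dev k \<omega> = (if k = 0 then 0 else S k \<omega> / (real k * \<mu>) - 1)"

definition scale :: "nat \<Rightarrow> real" where
  "scale n = \<mu> / \<sigma> / sqrt (real n)"

definition sum_path :: "nat \<Rightarrow> 'a \<Rightarrow> real \<Rightarrow> real" where
  "sum_path n \<omega> = step_path n (\<lambda>k. scale n * (real k * rel_dev k \<omega>))"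

definition log_path :: "nat \<Rightarrow> 'a \<Rightarrow> real \<Rightarrow> real" where
  "log_path n \<omega> = step_path n (\<lambda>m. scale n * (\<Sum>k\<le>m. ln (1 + rel_dev k \<omega>)))"

lemma scale_nonneg: "0 \<le> scale n"
  using \<mu>_pos \<sigma>_pos by (simp add: scale_def)

lemma rel_dev_measurable [measurable]: "rel_dev k \<in> borel_measurable M"
  unfolding rel_dev_def[abs_def] using S_measurable by (cases "k = 0") auto

lemma sum_path_eq:
  "sum_path n \<omega> t = ((if nat \<lfloor>real n * t\<rfloor> = 0 then 0 else S (nat \<lfloor>real n * t\<rfloor>) \<omega>)
     - real (nat \<lfloor>real n * t\<rfloor>) * \<mu>) / (\<sigma> * sqrt (real n))"
proof -
  have "scale n * (real k * rel_dev k \<omega>) =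
      ((if k = 0 then 0 else S k \<omega>) - real k * \<mu>) / (\<sigma> * sqrt (real n))" for k
    using \<mu>_pos \<sigma>_pos by (cases "n = 0") (auto simp: scale_def rel_dev_def field_simps)
  then show ?thesis by (simp add: sum_path_def step_path_def)
qed

lemma exp_log_path:
  assumes \<omega>: "\<omega> \<in> space M"
  shows "exp (log_path n \<omega> t) =
    (\<Prod>k\<in>{1..nat \<lfloor>real n * t\<rfloor>}. S k \<omega> / (real k * \<mu>)) powr ((\<mu> / \<sigma>) / sqrt (real n))"
proof -
  define m where "m = nat \<lfloor>real n * t\<rfloor>"
  have pos: "0 < S k \<omega> / (real k * \<mu>)" if "k \<in> {1..m}" for k
    using that S_pos[OF _ \<omega>] \<mu>_pos by auto
  have "(\<Sum>k\<le>m. ln (1 + rel_dev k \<omega>)) = (\<Sum>k\<in>{1..m}. ln (S k \<omega> / (real k * \<mu>)))"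
    by (rule sum.mono_neutral_cong_right) (auto simp: rel_dev_def)
  also have "\<dots> = ln (\<Prod>k\<in>{1..m}. S k \<omega> / (real k * \<mu>))"
    by (rule ln_prod[symmetric]) (use pos in force)+
  finally have "log_path n \<omega> t = scale n * ln (\<Prod>k\<in>{1..m}. S k \<omega> / (real k * \<mu>))"
    by (simp add: log_path_def step_path_def m_def)
  moreover have "0 < (\<Prod>k\<in>{1..m}. S k \<omega> / (real k * \<mu>))" using pos by (rule prod_pos)
  ultimately show ?thesis unfolding powr_def scale_def m_def by (metis less_irrefl)
qed

lemma random_element_log_path: "random_element D01 unif_dist M (log_path n)"
  unfolding log_path_def[abs_def]
  by (rule random_element_step_path[where z = "\<lambda>m \<omega>. scale n * (\<Sum>k\<le>m. ln (1 + rel_dev k \<omega>))"])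
       measurable

lemma random_element_sum_path: "random_element D01 skorokhod_dist M (sum_path n)"
  unfolding sum_path_def[abs_def]
  by (rule random_element_skorokhod_if_unif
      [OF random_element_step_path[where z = "\<lambda>k \<omega>. scale n * (real k * rel_dev k \<omega>)"]]) measurable

lemma rel_dev_integrable: "integrable M (rel_dev k)"
  and rel_dev_abs_expectation: "expectation (\<lambda>\<omega>. \<bar>rel_dev k \<omega>\<bar>) \<le> C / \<mu> * (1 / sqrt (real k))"
proof (atomize (full), cases "k = 0")
  case False
  then have [measurable]: "S k \<in> borel_measurable M" and k: "1 \<le> k" using S_measurable by auto
  have dev_integrable: "integrable M (\<lambda>\<omega>. S k \<omega> - real k * \<mu>)"
    using le_less_trans[OF S_moment[OF k] ennreal_less_top] by (intro integrableI_bounded) auto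
  have rel_dev_eq: "rel_dev k = (\<lambda>\<omega>. (S k \<omega> - real k * \<mu>) / (real k * \<mu>))"
    using k \<mu>_pos by (auto simp: rel_dev_def diff_divide_distrib)
  have "expectation (\<lambda>\<omega>. \<bar>S k \<omega> - real k * \<mu>\<bar>) \<le> C * sqrt (real k)"
    using S_moment[OF k] nn_integral_eq_integral[OF integrable_abs[OF dev_integrable]] C_nonneg
    by (simp add: ennreal_le_iff)
  then have "expectation (\<lambda>\<omega>. \<bar>rel_dev k \<omega>\<bar>) \<le> C * sqrt (real k) / (real k * \<mu>)"
    using \<mu>_pos by (simp add: rel_dev_eq abs_divide divide_right_mono)
  also have "\<dots> = C / \<mu> * (1 / sqrt (real k))"
    using k \<mu>_pos real_div_sqrt[of "real k"] by (simp add: field_simps)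
  finally show "integrable M (rel_dev k) \<and>
        expectation (\<lambda>\<omega>. \<bar>rel_dev k \<omega>\<bar>) \<le> C / \<mu> * (1 / sqrt (real k))"
    using dev_integrable by (simp add: rel_dev_eq)
qed (simp add: rel_dev_def[abs_def])

text \<open>The moment bound is summable along fourth powers, and monotonicity fills the gaps.\<close>
lemma rel_dev_tendsto_0: "AE \<omega> in M. (\<lambda>k. rel_dev k \<omega>) \<longlonglongrightarrow> 0"
proof -
  have "summable (\<lambda>j. expectation (\<lambda>\<omega>. \<bar>rel_dev (j ^ 4) \<omega>\<bar>))"
  proof (rule summable_comparison_test')
    show "summable (\<lambda>j. C / \<mu> * inverse (real j ^ 2))"
      by (intro summable_mult inverse_power_summable) simp
    have "sqrt (real (j ^ 4)) = real j ^ 2" for j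
      by (rule real_sqrt_unique) (simp_all flip: power_mult)
    then show "norm (expectation (\<lambda>\<omega>. \<bar>rel_dev (j ^ 4) \<omega>\<bar>)) \<le> C / \<mu> * inverse (real j ^ 2)" for j
      using rel_dev_abs_expectation[of "j ^ 4"] by (simp add: inverse_eq_divide)
  qed
  from AE_tendsto_0_if_summable_expectation[OF rel_dev_integrable this] AE_space show ?thesis
  proof eventually_elim
    case (elim \<omega>)
    have ratio: "\<mu> * (1 + rel_dev k \<omega>) = S k \<omega> / real k" if "0 < k" for k
      using that \<mu>_pos by (simp add: rel_dev_def)
    have "(\<lambda>k. S k \<omega> / real k) \<longlonglongrightarrow> \<mu>"
    proof (rule monotone_ratio_tendsto)
      show "filterlim (\<lambda>j::nat. j ^ 4) at_top sequentially"
        by (intro filterlim_subseq strict_monoI power_strict_mono) auto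
      have "(\<lambda>j. (real (Suc j) / real j) ^ 4) \<longlonglongrightarrow> 1 ^ 4"
        by (intro tendsto_power LIMSEQ_Suc_n_over_n)
      then show "(\<lambda>j. real (Suc j ^ 4) / real (j ^ 4)) \<longlonglongrightarrow> 1"
        by (simp add: power_divide)
      have "(\<lambda>j. \<mu> * (1 + rel_dev (j ^ 4) \<omega>)) \<longlonglongrightarrow> \<mu> * (1 + 0)"
        using elim(1) by (intro tendsto_intros)
      moreover have "\<forall>\<^sub>F j in sequentially. \<mu> * (1 + rel_dev (j ^ 4) \<omega>) =
          S (j ^ 4) \<omega> / real (j ^ 4)"
        using eventually_gt_at_top[of 0] by eventually_elim (simp add: ratio)
      ultimately show "(\<lambda>j. S (j ^ 4) \<omega> / real (j ^ 4)) \<longlonglongrightarrow> \<mu>"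
        by (simp add: tendsto_cong)
    qed (use S_pos S_mono elim(2) in \<open>auto simp: less_imp_le\<close>)
    then have "(\<lambda>k. S k \<omega> / real k / \<mu> - 1) \<longlonglongrightarrow> \<mu> / \<mu> - 1"
      using \<mu>_pos by (intro tendsto_intros) auto
    moreover have "\<forall>\<^sub>F k in sequentially. S k \<omega> / real k / \<mu> - 1 = rel_dev k \<omega>"
      using eventually_gt_at_top[of 0] by eventually_elim (simp add: rel_dev_def)
    ultimately show ?case using \<mu>_pos by (simp add: tendsto_cong)
  qed
qed

lemma log_error_dominated_with_high_prob:
  assumes \<delta>: "0 < \<delta>" and \<eta>: "0 < \<eta>"
  obtains G L where "G \<in> events" "prob (space M - G) < \<eta>" "0 \<le> L"
    "\<And>\<omega>. \<omega> \<in> G \<Longrightarrow> log_error_dominated \<delta> L (\<lambda>k. rel_dev k \<omega>)"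
proof -
  define G where "G L = {\<omega> \<in> space M. log_error_dominated \<delta> (real L) (\<lambda>k. rel_dev k \<omega>)}" for L :: nat
  have G_events: "G L \<in> events" for L
    unfolding G_def log_error_dominated_def log_error_def by measurable
  have "incseq G"
    unfolding incseq_def G_def log_error_dominated_def by (auto intro: order_trans)
  then have "(\<lambda>L. prob (G L)) \<longlonglongrightarrow> prob (\<Union>L. G L)"
    using G_events by (intro finite_Lim_measure_incseq) auto
  moreover have "AE \<omega> in M. \<omega> \<in> (\<Union>L. G L)"
    using rel_dev_tendsto_0 AE_space
    by eventually_elim (use log_error_dominated_if_tendsto_0[OF _ \<delta>] in \<open>auto simp: G_def\<close>)
  then have "prob (\<Union>L. G L) = 1" using G_events by (subst prob_eq_1) auto
  ultimately have "\<forall>\<^sub>F L in sequentially. 1 - \<eta> < prob (G L)"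
    using \<eta> by (intro order_tendstoD(1)) auto
  then obtain L where "1 - \<eta> < prob (G L)" by (auto simp: eventually_sequentially)
  then have "prob (space M - G L) < \<eta>" using prob_compl[OF G_events[of L]] by simp
  then show thesis by (intro that[of "G L" "real L"] G_events) (auto simp: G_def)
qed

definition path_error :: "real \<Rightarrow> real \<Rightarrow> real \<Rightarrow> nat \<Rightarrow> 'a \<Rightarrow> real" where
  "path_error \<delta> L \<epsilon> n \<omega> = scale n *
     (2 * L + \<delta> * (\<Sum>k\<le>n. \<bar>rel_dev k \<omega>\<bar>) + (\<Sum>k\<le>nat \<lfloor>\<epsilon> * real n\<rfloor>. \<bar>rel_dev k \<omega>\<bar>))"

lemma unif_dist_sum_path_log_path_le:
  assumes "0 < n" and "0 < \<epsilon>" and dom: "log_error_dominated \<delta> L (\<lambda>k. rel_dev k \<omega>)"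
  shows "unif_dist (div_integral \<epsilon> (sum_path n \<omega>)) (log_path n \<omega>) \<le> path_error \<delta> L \<epsilon> n \<omega>"
proof -
  have "unif_dist (div_integral \<epsilon> (sum_path n \<omega>)) (log_path n \<omega>)
      \<le> scale n * (L + log_error (\<lambda>k. rel_dev k \<omega>) n + (\<Sum>k\<le>nat \<lfloor>\<epsilon> * real n\<rfloor>. \<bar>rel_dev k \<omega>\<bar>))"
    unfolding sum_path_def log_path_def using assms scale_nonneg
    by (intro unif_dist_div_integral_log_sum_le) (auto simp: rel_dev_def log_error_dominated_def)
  also have "\<dots> \<le> path_error \<delta> L \<epsilon> n \<omega>"
    unfolding path_error_def using dom scale_nonneg[of n]
    by (intro mult_left_mono) (auto simp: log_error_dominated_def)
  finally show ?thesis .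
qed

lemma abs_rel_dev_sum_expectation:
  "expectation (\<lambda>\<omega>. \<Sum>k\<le>m. \<bar>rel_dev k \<omega>\<bar>) \<le> 2 * C / \<mu> * sqrt (real m)"
proof -
  have "expectation (\<lambda>\<omega>. \<Sum>k\<le>m. \<bar>rel_dev k \<omega>\<bar>) = (\<Sum>k\<le>m. expectation (\<lambda>\<omega>. \<bar>rel_dev k \<omega>\<bar>))"
    by (intro Bochner_Integration.integral_sum integrable_abs rel_dev_integrable)
  also have "\<dots> \<le> (\<Sum>k\<le>m. C / \<mu> * (1 / sqrt (real k)))"
    by (intro sum_mono rel_dev_abs_expectation)
  also have "\<dots> = C / \<mu> * (\<Sum>k\<le>m. 1 / sqrt (real k))" by (simp add: sum_distrib_left)
  also have "\<dots> \<le> C / \<mu> * (2 * sqrt (real m))"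
    using C_nonneg \<mu>_pos by (intro mult_left_mono sum_inverse_sqrt_le) auto
  finally show ?thesis by (simp add: mult_ac)
qed

lemma path_error_integrable: "integrable M (path_error \<delta> L \<epsilon> n)"
  unfolding path_error_def[abs_def] using rel_dev_integrable
  by (intro integrable_mult_right Bochner_Integration.integrable_add
      Bochner_Integration.integrable_sum integrable_abs) auto

lemma path_error_expectation:
  assumes n: "0 < n" and "0 \<le> \<delta>" and "0 \<le> \<epsilon>"
  shows "expectation (path_error \<delta> L \<epsilon> n)
    \<le> \<mu> / \<sigma> * (2 * L / sqrt (real n)) + 2 * C / \<sigma> * \<delta> + 2 * C / \<sigma> * sqrt \<epsilon>"
proof -
  define A where "A m \<omega> = (\<Sum>k\<le>m. \<bar>rel_dev k \<omega>\<bar>)" for m \<omega>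
  have A_integrable: "integrable M (A m)" for m
    unfolding A_def by (intro Bochner_Integration.integrable_sum integrable_abs rel_dev_integrable)
  have A_expectation: "expectation (A m) \<le> 2 * C / \<mu> * sqrt (real m)" for m
    unfolding A_def by (rule abs_rel_dev_sum_expectation)
  define m where "m = nat \<lfloor>\<epsilon> * real n\<rfloor>"
  have "real m \<le> \<epsilon> * real n" unfolding m_def using assms by simp
  then have "2 * C / \<mu> * sqrt (real m) \<le> 2 * C / \<mu> * sqrt (\<epsilon> * real n)"
    using C_nonneg \<mu>_pos by (intro mult_left_mono) auto
  with A_expectation[of m] have A_m: "expectation (A m) \<le> 2 * C / \<mu> * sqrt (\<epsilon> * real n)" by linarith
  have "expectation (path_error \<delta> L \<epsilon> n) =
      scale n * (2 * L + \<delta> * expectation (A n) + expectation (A m))"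
    unfolding path_error_def[abs_def] A_def[symmetric] m_def[symmetric]
    using A_integrable by (simp add: prob_space)
  also have "\<dots> \<le> scale n * (2 * L + \<delta> * (2 * C / \<mu> * sqrt (real n))
      + 2 * C / \<mu> * sqrt (\<epsilon> * real n))"
    using assms scale_nonneg A_expectation A_m by (intro mult_left_mono add_mono) auto
  also have "\<dots> = \<mu> / \<sigma> * (2 * L / sqrt (real n)) + 2 * C / \<sigma> * \<delta> + 2 * C / \<sigma> * sqrt \<epsilon>"
    using n \<mu>_pos \<sigma>_pos unfolding scale_def real_sqrt_mult by (simp add: field_simps)
  finally show ?thesis .
qed

lemma path_error_expectation_eventually_le:
  assumes b: "0 < b" and \<epsilon>: "\<And>j. 0 < \<epsilon> j" "\<epsilon> \<longlonglongrightarrow> 0"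
  obtains \<delta> where "0 < \<delta>" "\<And>L. \<forall>\<^sub>F j in sequentially. \<forall>\<^sub>F n in sequentially.
    expectation (path_error \<delta> L (\<epsilon> j) n) \<le> b"
proof -
  define K where "K = 2 * C / \<sigma>"
  have "0 \<le> K" using C_nonneg \<sigma>_pos by (simp add: K_def)
  define \<delta> where "\<delta> = b / 3 / (K + 1)"
  have \<delta>: "0 < \<delta>" "K * \<delta> \<le> b / 3" using b \<open>0 \<le> K\<close> by (auto simp: \<delta>_def field_simps)
  have "(\<lambda>j. K * sqrt (\<epsilon> j)) \<longlonglongrightarrow> K * sqrt 0"
    by (intro tendsto_intros \<epsilon>)
  then have small_\<epsilon>: "\<forall>\<^sub>F j in sequentially. K * sqrt (\<epsilon> j) < b / 3"
    using b by (intro order_tendstoD(2)) auto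
  have "\<forall>\<^sub>F j in sequentially. \<forall>\<^sub>F n in sequentially. expectation (path_error \<delta> L (\<epsilon> j) n) \<le> b" for L
    using small_\<epsilon>
  proof eventually_elim
    case (elim j)
    have "(\<lambda>n. \<mu> / \<sigma> * (2 * L / sqrt (real n))) \<longlonglongrightarrow> \<mu> / \<sigma> * 0"
      by (intro tendsto_intros real_tendsto_divide_at_top[OF tendsto_const]
        filterlim_compose[OF sqrt_at_top filterlim_real_sequentially])
    then have "\<forall>\<^sub>F n in sequentially. \<mu> / \<sigma> * (2 * L / sqrt (real n)) < b / 3"
      using b by (intro order_tendstoD(2)) auto
    then show ?case
      using eventually_gt_at_top[of 0]
    proof eventually_elim
      fix n :: nat assume n: "\<mu> / \<sigma> * (2 * L / sqrt (real n)) < b / 3" "0 < n"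
      have "expectation (path_error \<delta> L (\<epsilon> j) n)
          \<le> \<mu> / \<sigma> * (2 * L / sqrt (real n)) + K * \<delta> + K * sqrt (\<epsilon> j)"
        unfolding K_def using \<delta>(1) \<epsilon>(1)[of j] by (intro path_error_expectation n(2)) simp_all
      with n(1) \<delta>(2) elim show "expectation (path_error \<delta> L (\<epsilon> j) n) \<le> b" by simp
    qed
  qed
  with \<delta>(1) show thesis by (rule that)
qed

lemma div_integral_sum_path_close_to_log_path:
  assumes e: "0 < e" and \<epsilon>: "\<And>j. 0 < \<epsilon> j" "\<epsilon> \<longlonglongrightarrow> 0"
  shows "\<forall>\<^sub>F j in sequentially. \<forall>\<^sub>F n in sequentially.
    close_in_prob unif_dist e M (\<lambda>\<omega>. div_integral (\<epsilon> j) (sum_path n \<omega>)) (log_path n)"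
proof -
  have "0 < e\<^sup>2 / 2" using e by simp
  then obtain \<delta> where \<delta>: "0 < \<delta>" and small: "\<And>L. \<forall>\<^sub>F j in sequentially. \<forall>\<^sub>F n in sequentially.
      expectation (path_error \<delta> L (\<epsilon> j) n) \<le> e\<^sup>2 / 2"
    using path_error_expectation_eventually_le[OF _ \<epsilon>] by blast
  obtain G L where G: "G \<in> events" "prob (space M - G) < e / 2" and L: "0 \<le> L"
    and dom: "\<And>\<omega>. \<omega> \<in> G \<Longrightarrow> log_error_dominated \<delta> L (\<lambda>k. rel_dev k \<omega>)"
    using log_error_dominated_with_high_prob[OF \<delta> half_gt_zero[OF e]] by blast
  from small[of L] show ?thesis
  proof eventually_elim
    case (elim j)
    then show ?case
      using eventually_gt_at_top[of 0]
    proof eventually_elim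
      fix n :: nat assume expectation: "expectation (path_error \<delta> L (\<epsilon> j) n) \<le> e\<^sup>2 / 2"
        and n: "0 < n"
      show "close_in_prob unif_dist e M (\<lambda>\<omega>. div_integral (\<epsilon> j) (sum_path n \<omega>)) (log_path n)"
      proof (rule close_in_prob_if_dominated[OF e G(1) less_imp_le[OF G(2)]
          path_error_integrable _ expectation])
        show "0 \<le> path_error \<delta> L (\<epsilon> j) n \<omega>" for \<omega>
          unfolding path_error_def using \<delta> L scale_nonneg
          by (intro mult_nonneg_nonneg add_nonneg_nonneg sum_nonneg) auto
        show "unif_dist (div_integral (\<epsilon> j) (sum_path n \<omega>)) (log_path n \<omega>)
          \<le> path_error \<delta> L (\<epsilon> j) n \<omega>"
          if "\<omega> \<in> G" for \<omega>
          by (rule unif_dist_sum_path_log_path_le[OF n \<epsilon>(1) dom[OF that]])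
      qed
    qed
  qed
qed

theorem log_path_converges_weakly:
  assumes W: "standard_wiener_process N W" and conv: "conv_distr_D M sum_path N (\<lambda>\<omega> t. W t \<omega>)"
  shows "converges_weakly D01 unif_dist M log_path N (\<lambda>\<omega>. div_integral 0 (\<lambda>t. W t \<omega>))"
proof (rule unif.converging_together)
  define \<epsilon> where "\<epsilon> j = 1 / real (Suc j)" for j
  have \<epsilon>: "\<epsilon> j \<in> {0<..1}" "0 < \<epsilon> j" for j
    by (auto simp: \<epsilon>_def)
  have \<epsilon>_tendsto: "\<epsilon> \<longlonglongrightarrow> 0"
    unfolding \<epsilon>_def[abs_def] by (rule LIMSEQ_Suc[OF lim_1_over_n])
  show "random_element D01 unif_dist M (\<lambda>\<omega>. div_integral (\<epsilon> j) (sum_path n \<omega>))" for j n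
    by (rule random_element_compose[OF random_element_sum_path div_integral_seq_continuous[OF \<epsilon>(2)]])
  have "converges_weakly D01 skorokhod_dist M sum_path N (\<lambda>\<omega> t. W t \<omega>)"
    using conv conv_distr_D_iff_converges_weakly[of M sum_path N, OF random_element_sum_path
      random_element_skorokhod_if_unif[OF random_element_wiener[OF W]]] by blast
  then show "converges_weakly D01 unif_dist M (\<lambda>n \<omega>. div_integral (\<epsilon> j) (sum_path n \<omega>)) N
      (\<lambda>\<omega>. div_integral (\<epsilon> j) (\<lambda>t. W t \<omega>))" for j
    by (rule converges_weakly_compose[OF _ div_integral_seq_continuous[OF \<epsilon>(2)]])
  show "converges_weakly D01 unif_dist N (\<lambda>j \<omega>. div_integral (\<epsilon> j) (\<lambda>t. W t \<omega>))
    N (\<lambda>\<omega>. div_integral 0 (\<lambda>t. W t \<omega>))"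
    by (rule wiener_div_integral_converges_weakly[OF W \<epsilon>(1) \<epsilon>_tendsto])
  show "\<forall>\<^sub>F j in sequentially. \<forall>\<^sub>F n in sequentially.
      close_in_prob unif_dist e M (\<lambda>\<omega>. div_integral (\<epsilon> j) (sum_path n \<omega>)) (log_path n)"
    if "0 < e" for e
    by (rule div_integral_sum_path_close_to_log_path[OF that \<epsilon>(2) \<epsilon>_tendsto])
  show "prob_space N" using W by (simp add: standard_wiener_process_def)
qed (intro prob_space_axioms random_element_log_path random_element_wiener_div_integral W)+

theorem exp_log_path_conv_distr:
  assumes W: "standard_wiener_process N W" and conv: "conv_distr_D M sum_path N (\<lambda>\<omega> t. W t \<omega>)"
  shows "conv_distr_D M (\<lambda>n \<omega> t. exp (log_path n \<omega> t)) N (\<lambda>\<omega> t. exp (div_integral 0 (\<lambda>t. W t \<omega>) t))"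
proof -
  have exp_continuous: "seq_continuous D01 unif_dist D01 skorokhod_dist (\<lambda>x t. exp (x t :: real))"
    by (rule seq_continuous_compose[OF pointwise_map_unif_continuous id_unif_skorokhod_continuous])
       (intro continuous_intros)
  show ?thesis
    by (rule conv_distr_D_iff_converges_weakly[THEN iffD2])
       (rule random_element_compose[OF random_element_log_path exp_continuous]
          random_element_compose[OF random_element_wiener_div_integral[OF W] exp_continuous]
          converges_weakly_compose[OF log_path_converges_weakly[OF W conv] exp_continuous])+
qed

end

theorem theorem1p1:
  fixes M :: "'a measure" and N :: "'b measure"
    and S :: "nat \<Rightarrow> 'a \<Rightarrow> real" and W :: "real \<Rightarrow> 'b \<Rightarrow> real"
    and \<mu> \<sigma> :: real
  assumes "prob_space M"
    and "\<forall>k\<ge>1. S k \<in> borel_measurable M"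
    and "\<forall>k\<ge>1. \<forall>\<omega>\<in>space M. 0 < S k \<omega>"
    and "\<forall>k\<ge>1. \<forall>\<omega>\<in>space M. S k \<omega> \<le> S (Suc k) \<omega>"
    and "standard_wiener_process N W"
    and "0 < \<mu>" and "0 < \<sigma>"
    and "conv_distr_D M
           (\<lambda>n \<omega> t. ((if nat \<lfloor>real n * t\<rfloor> = 0 then 0 else S (nat \<lfloor>real n * t\<rfloor>) \<omega>)
                       - real (nat \<lfloor>real n * t\<rfloor>) * \<mu>) / (\<sigma> * sqrt (real n)))
           N (\<lambda>\<omega> t. W t \<omega>)"
    and "\<exists>C::real. \<forall>n\<ge>1. (\<integral>\<^sup>+\<omega>. ennreal \<bar>S n \<omega> - real n * \<mu>\<bar> \<partial>M) \<le> ennreal (C * sqrt (real n))"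
  shows "conv_distr_D M
           (\<lambda>n \<omega> t. (\<Prod>k\<in>{1..nat \<lfloor>real n * t\<rfloor>}. S k \<omega> / (real k * \<mu>)) powr ((\<mu> / \<sigma>) / sqrt (real n)))
           N (\<lambda>\<omega> t. exp (LINT x:{0..t}|lborel. W x \<omega> / x))"
proof -
  obtain C where C: "\<And>n. 1 \<le> n \<Longrightarrow> (\<integral>\<^sup>+\<omega>. ennreal \<bar>S n \<omega> - real n * \<mu>\<bar> \<partial>M) \<le> ennreal (C * sqrt (real n))"
    using assms(9) by blast
  have "(\<integral>\<^sup>+\<omega>. ennreal \<bar>S n \<omega> - real n * \<mu>\<bar> \<partial>M) \<le> ennreal (\<bar>C\<bar> * sqrt (real n))" if "1 \<le> n" for n
    by (rule order_trans[OF C[OF that]]) (auto intro!: ennreal_leI mult_right_mono)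
  then interpret monotone_sums M S \<mu> \<sigma> "\<bar>C\<bar>"
    using assms by (intro monotone_sums.intro monotone_sums_axioms.intro) auto
  have "conv_distr_D M sum_path N (\<lambda>\<omega> t. W t \<omega>)"
    using assms(8) by (simp add: sum_path_eq[abs_def])
  from exp_log_path_conv_distr[OF assms(5) this, unfolded div_integral_def] show ?thesis
    by (rule conv_distr_D_cong) (intro ext exp_log_path)
qed

end
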